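(* Let $0<\alpha\le1$ and $\rho>1$, and set $\beta=\max\left(3,\sqrt{1+4/\alpha}\right)\rho\,\pi$. Let $\tilde f:[-\pi,\pi]^2\to\mathbb{C}$ be a BMC function such that $\tilde f(\lambda,\cdot)$ is continuous for any $\lambda\in[-\pi,\pi]$, and such that $\tilde f(\cdot,\theta)$ is analytic and uniformly bounded in the stadium $S_\beta$ of radius $\beta$ (about $[-\pi,\pi]$) for any $\theta\in[-\pi,\pi]$. Then the error $\tilde e_k$ after $k$ steps of the structure-preserving Gaussian elimination (GE) procedure with coupling parameter $\alpha$ applied to $\tilde f$ satisfies $$\|\tilde e_k\|_\infty\to0\qquad\text{as }k\to\infty .$$ That is, the sequence of approximants $\tilde f_k$ constructed by the procedure converges uniformly to $\tilde f$.
   Context: $\|\cdot\|_\infty$ denotes the absolute maximum over $[-\pi,\pi]^2$. **Stadium.** For $\beta>0$, $S_\beta$ is the set of all complex numbers lying at distance $\le\beta$ from the interval $[-\pi,\pi]$: $S_\beta=\{z\in\mathbb{C}:\inf_{x\in[-\pi,\pi]}|z-x|\le\beta\}$. "Analytic and uniformly bounded in $S_\beta$ for any $\theta$" means that for each $\theta\in[-\pi,\pi]$ the function $\tilde f(\cdot,\theta)$ extends analytically to $S_\beta$, with the extensions bounded on $S_\beta$ by a constant independent of $\theta$. **BMC functions.** A function $\tilde f:[-\pi,\pi]^2\to\mathbb{C}$ of variables $(\lambda,\theta)$ is a block-mirror-centrosymmetric (BMC) function if there are functions $g,h:[0,\pi]\times[0,\pi]\to\mathbb{C}$ such that $$\tilde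 f(\lambda,\theta)=\begin{cases} g(\lambda+\pi,\theta), & (\lambda,\theta)\in[-\pi,0]\times[0,\pi],\\ h(\lambda,\theta), & (\lambda,\theta)\in[0,\pi]\times[0,\pi],\\ g(\lambda,-\theta), & (\lambda,\theta)\in[0,\pi]\times[-\pi,0],\\ h(\lambda+\pi,-\theta), & (\lambda,\theta)\in[-\pi,0]\times[-\pi,0]\end{cases}$$ (all four formulas hold, including on overlaps). **Pseudoinverse of pivot matrices.** Let $M=\begin{bmatrix} a&b\\ b&a\end{bmatrix}\ne 0$ with $a,b\in\mathbb{C}$. Its singular values are $\sigma_1(M)=\max\{|a+b|,|a-b|\}$ and $\sigma_2(M)=\min\{|a+b|,|a-b|\}$. Put $\epsilon=\alpha\sigma_1(M)$ and define $$M^{\dagger_\epsilon}=\frac12\begin{bmatrix}1&1\\1&-1\end{bmatrix}\begin{bmatrix} m^+&0\\0&m^-\end{bmatrix}\begin{bmatrix}1&1\\1&-1\end{bmatrix},$$ where $(m^+,m^-)=(1/(a+b),0)$ if $|a-b|<\alpha|a+b|$; $(m^+,m^-)=(0,1/(a-b))$ if $|a+b|<\alpha|a-b|$; and $(m^+,m^-)=(1/(a+b),1/(a-b))$ otherwise (so that $M^{\dagger_\epsilon}=M^{-1}$ in this last case). **Structure-preserving GE procedure** with coupling parameter $\alpha$, applied to a BMC function $\tilde f$. Set $\tilde f_0=0$, $\tilde e_0=\tilde f$. For $k=1,2,3,\ldots$, as long as $\tilde e_{k-1}\neq0$: choose any $(\lambda_k,\theta_k)\in[0,\pi]^2$ such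 that the matrix $M=\begin{bmatrix} a&b\\ b&a\end{bmatrix}$ with $a=\tilde e_{k-1}(\lambda_k-\pi,\theta_k)$, $b=\tilde e_{k-1}(\lambda_k,\theta_k)$ has maximal $\sigma_1(M)$ over all points of $[0,\pi]^2$; set $\epsilon=\alpha\sigma_1(M)$, let $$U_k(\lambda,\theta)=\begin{bmatrix}\tilde e_{k-1}(\lambda_k-\pi,\theta)&\tilde e_{k-1}(\lambda_k,\theta)\end{bmatrix}M^{\dagger_\epsilon}\begin{bmatrix}\tilde e_{k-1}(\lambda,\theta_k)\\ \tilde e_{k-1}(\lambda,-\theta_k)\end{bmatrix},$$ and set $\tilde e_k=\tilde e_{k-1}-U_k$ and $\tilde f_k=\tilde f_{k-1}+U_k$. If $\tilde e_{k}=0$ for some $k$, the procedure stops and one sets $\tilde e_j=0$, $\tilde f_j=\tilde f_k$ for all $j\ge k$. The claim is for any choice of maximizers. *)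

theory Defs
  imports "HOL-Complex_Analysis.Complex_Analysis"
begin

text \<open>Functions on the square \<open>[-\<pi>,\<pi>]\<^sup>2\<close> are represented by total curried functions of
  \<open>(\<lambda>,\<theta>)\<close> of which only the values on the square matter: no definition below constrains
  values outside it.\<close>

definition supnorm :: "(real \<Rightarrow> real \<Rightarrow> complex) \<Rightarrow> real" where
  "supnorm u = (SUP (l, t) \<in> {-pi..pi} \<times> {-pi..pi}. cmod (u l t))"

definition stadium :: "real \<Rightarrow> complex set" where
  "stadium \<beta> = {z. infdist z (complex_of_real ` {-pi..pi}) \<le> \<beta>}"

text \<open>The stadium is closed, so \<open>analytic_on\<close> (holomorphic in a neighbourhood of every point of
  the set) is the right notion. The bound \<open>C\<close> is independent of \<open>t\<close>.\<close>

definition analytic_bounded_in_stadium :: "real \<Rightarrow> (real \<Rightarrow> real \<Rightarrow> complex) \<Rightarrow> bool" where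
  "analytic_bounded_in_stadium \<beta> f \<longleftrightarrow>
     (\<exists>C. \<forall>t\<in>{-pi..pi}. \<exists>F. F analytic_on stadium \<beta> \<and>
        (\<forall>l\<in>{-pi..pi}. F (complex_of_real l) = f l t) \<and>
        (\<forall>z\<in>stadium \<beta>. cmod (F z) \<le> C))"

definition BMC :: "(real \<Rightarrow> real \<Rightarrow> complex) \<Rightarrow> bool" where
  "BMC f \<longleftrightarrow> (\<exists>g h :: real \<Rightarrow> real \<Rightarrow> complex.
     (\<forall>l\<in>{-pi..0}. \<forall>t\<in>{0..pi}. f l t = g (l + pi) t) \<and>
     (\<forall>l\<in>{0..pi}. \<forall>t\<in>{0..pi}. f l t = h l t) \<and>
     (\<forall>l\<in>{0..pi}. \<forall>t\<in>{-pi..0}. f l t = g l (- t)) \<and>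
     (\<forall>l\<in>{-pi..0}. \<forall>t\<in>{-pi..0}. f l t = h (l + pi) (- t)))"

definition pivot_mat :: "complex \<Rightarrow> complex \<Rightarrow> complex^2^2" where
  "pivot_mat a b = vector [vector [a, b], vector [b, a]]"

text \<open>\<open>sigma1\<close>, \<open>sigma2\<close> and \<open>pinv\<close> are only meant for matrices of the form \<open>pivot_mat a b\<close>, whose
  entries \<open>a\<close> and \<open>b\<close> they read off the first row.\<close>

definition sigma1 :: "complex^2^2 \<Rightarrow> real" where
  "sigma1 M = max (cmod (M$1$1 + M$1$2)) (cmod (M$1$1 - M$1$2))"

definition sigma2 :: "complex^2^2 \<Rightarrow> real" where
  "sigma2 M = min (cmod (M$1$1 + M$1$2)) (cmod (M$1$1 - M$1$2))"

text \<open>These are indeed the singular values: their squares are the eigenvalues of \<open>M\<^sup>* M\<close>.\<close>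

lemma pivot_mat_singular_values:
  fixes a b x :: complex
  defines "M \<equiv> pivot_mat a b"
  defines "H \<equiv> (\<chi> i j. cnj (M $ j $ i)) :: complex^2^2"
  shows "det (mat x - H ** M) = (x - of_real ((sigma1 M)\<^sup>2)) * (x - of_real ((sigma2 M)\<^sup>2))"
proof -
  have *: "complex_of_real ((cmod w)\<^sup>2) = w * cnj w" for w
    by (rule complex_norm_square)
  have "(x - of_real ((sigma1 M)\<^sup>2)) * (x - of_real ((sigma2 M)\<^sup>2)) =
        (x - of_real ((cmod (a + b))\<^sup>2)) * (x - of_real ((cmod (a - b))\<^sup>2))"
    unfolding M_def sigma1_def sigma2_def pivot_mat_def
    by (simp add: max_def min_def mult.commute)
  also have "\<dots> = det (mat x - H ** M)"
    unfolding * by (simp add: det_2 M_def H_def pivot_mat_def mat_def matrix_matrix_mult_def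
        sum_2 algebra_simps)
  finally show ?thesis by simp
qed

definition hadamard2 :: "complex^2^2" where
  "hadamard2 = vector [vector [1, 1], vector [1, -1]]"

text \<open>The matrix \<open>M\<^sup>\<dagger>\<close> with threshold \<open>\<epsilon> = \<alpha> * sigma1 M\<close>, for nonzero \<open>M = pivot_mat a b\<close>:
  singular values below the threshold are dropped.\<close>

definition pinv :: "real \<Rightarrow> complex^2^2 \<Rightarrow> complex^2^2" where
  "pinv \<alpha> M =
     (let a = M$1$1; b = M$1$2;
          (mp, mm) =
            (if cmod (a - b) < \<alpha> * cmod (a + b) then (1 / (a + b), 0)
             else if cmod (a + b) < \<alpha> * cmod (a - b) then (0, 1 / (a - b))
             else (1 / (a + b), 1 / (a - b)))
      in mat (1/2) ** hadamard2 ** vector [vector [mp, 0], vector [0, mm]] ** hadamard2)"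

definition pivot_at :: "(real \<Rightarrow> real \<Rightarrow> complex) \<Rightarrow> real \<Rightarrow> real \<Rightarrow> complex^2^2" where
  "pivot_at e l t = pivot_mat (e (l - pi) t) (e l t)"

definition maximal_pivot :: "(real \<Rightarrow> real \<Rightarrow> complex) \<Rightarrow> real \<Rightarrow> real \<Rightarrow> bool" where
  "maximal_pivot e l0 t0 \<longleftrightarrow> l0 \<in> {0..pi} \<and> t0 \<in> {0..pi} \<and>
     (\<forall>l\<in>{0..pi}. \<forall>t\<in>{0..pi}. sigma1 (pivot_at e l t) \<le> sigma1 (pivot_at e l0 t0))"

definition GE_update ::
  "real \<Rightarrow> (real \<Rightarrow> real \<Rightarrow> complex) \<Rightarrow> real \<Rightarrow> real \<Rightarrow> real \<Rightarrow> real \<Rightarrow> complex" where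
  "GE_update \<alpha> e l0 t0 l t =
     (let r = vector [e (l0 - pi) t, e l0 t] :: complex^2;
          c = vector [e l t0, e l (- t0)] :: complex^2
      in \<Sum>i\<in>UNIV. r$i * (pinv \<alpha> (pivot_at e l0 t0) *v c)$i)"

text \<open>\<open>GE_run \<alpha> f e fa\<close>: \<open>e k\<close> and \<open>fa k\<close> are the errors and the approximants of some execution
  of the procedure on \<open>f\<close>. The maximal pivot of each step is arbitrary.\<close>

definition GE_run :: "real \<Rightarrow> (real \<Rightarrow> real \<Rightarrow> complex) \<Rightarrow>
    (nat \<Rightarrow> real \<Rightarrow> real \<Rightarrow> complex) \<Rightarrow> (nat \<Rightarrow> real \<Rightarrow> real \<Rightarrow> complex) \<Rightarrow> bool" where
  "GE_run \<alpha> f e fa \<longleftrightarrow>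
     (\<forall>l\<in>{-pi..pi}. \<forall>t\<in>{-pi..pi}. e 0 l t = f l t \<and> fa 0 l t = 0) \<and>
     (\<forall>k. if \<exists>l\<in>{-pi..pi}. \<exists>t\<in>{-pi..pi}. e k l t \<noteq> 0
          then \<exists>l0 t0. maximal_pivot (e k) l0 t0 \<and>
                 (\<forall>l\<in>{-pi..pi}. \<forall>t\<in>{-pi..pi}.
                    e (Suc k) l t = e k l t - GE_update \<alpha> (e k) l0 t0 l t \<and>
                    fa (Suc k) l t = fa k l t + GE_update \<alpha> (e k) l0 t0 l t)
          else \<forall>l\<in>{-pi..pi}. \<forall>t\<in>{-pi..pi}. e (Suc k) l t = 0 \<and> fa (Suc k) l t = fa k l t)"

end

theory Submission
  imports Defs "Jordan_Normal_Form.Determinant"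
begin

text \<open>On \<open>[0,\<pi>]\<^sup>2\<close> consider the two modes \<open>e (\<lambda> - \<pi>) \<theta> + e \<lambda> \<theta>\<close> and \<open>e (\<lambda> - \<pi>) \<theta> - e \<lambda> \<theta>\<close> of the
  error. They diagonalise every pivot matrix, \<open>sigma1\<close> is the larger of their two moduli, and by the
  symmetry of the function a step of the procedure is an ordinary rank-one elimination step on each
  mode whose pivot is at least \<open>\<alpha>\<close> times the pivot of the other mode; a mode that fails this test stays
  unchanged (\<open>GE_step_mode\<close>). So two scalar eliminations run side by side, coupled only by their
  common pivot positions. Let \<open>S k\<close> be the maximal \<open>sigma1\<close> in step \<open>k\<close>; it bounds the error, and the
  claim is that it tends to \<open>0\<close>. This is shown by estimating the product of all pivots used up to a
  step \<open>K\<close> from both sides.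

  From above: in one mode, the product of the first \<open>n\<close> pivots is the determinant of the samples of
  that mode of \<open>f\<close> at the pivot points (\<open>elimination_determinant\<close>). The rows of this matrix sample
  analytic functions whose Taylor coefficients, on the scale of the interval, decay geometrically. In
  the expansion of the determinant into generalised Vandermonde determinants all exponents must be
  distinct, hence they sum to at least \<open>n (n - 1) / 2\<close>, and with \<open>h\<^sup>2 = 2 \<gamma>\<close>, where
  \<open>\<gamma> = max 3 (sqrt (1 + 4 / \<alpha>))\<close>, the determinant is at most \<open>n! D\<^sup>n\<close> divided by
  \<open>h\<close> to the power \<open>n (n - 1)\<close> (\<open>interpolation_determinant_bound\<close>, \<open>mode_determinant_bound\<close>).

  From below: each pivot used in step \<open>k\<close> has modulus at least \<open>\<alpha> * S k\<close>, and \<open>S\<close> cannot grow fast, so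
  if \<open>S K\<close> is not small, neither are the earlier \<open>S j\<close>. The growth of \<open>S\<close> itself is irregular;
  regular is the growth of the potential \<open>max (P * Q) (\<alpha> * (max P Q)\<^sup>2)\<close>, where \<open>P\<close> and \<open>Q\<close> are the
  sup norms of the modes. It is comparable to \<open>(S k)\<^sup>2\<close> and grows at most by the factor \<open>4\<close> in
  a step with one pivot and \<open>2 + 2/\<alpha>\<close> in a step with two (\<open>T_step\<close>), that is, by at most \<open>g\<^sup>2\<close>
  per pivot with \<open>g\<^sup>2 = 4 \<gamma> / 3\<close>.

  With \<open>W\<close> pivots used up to step \<open>K\<close>, the upper bound is \<open>h\<close> to the power \<open>- W\<^sup>2 / 2\<close>, and the lower
  bound is \<open>(S K) ^ W\<close> times \<open>g\<close> to the power \<open>- W\<^sup>2 / 2\<close>, both up to factors of lower order. Since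
  \<open>g < h\<close>, taking the root of order \<open>W\<close> forces \<open>S K\<close> to \<open>0\<close> (\<open>S_quadratic_exponent_bound\<close>, \<open>S_tendsto_0\<close>).\<close>

section \<open>Determinants of samples of analytic functions\<close>

lemma norm_det_le:
  fixes A :: "complex Matrix.mat"
  assumes A: "A \<in> carrier_mat n n" and B: "\<And>i j. i < n \<Longrightarrow> j < n \<Longrightarrow> norm (A $$ (i, j)) \<le> B"
  shows "norm (Determinant.det A) \<le> fact n * B ^ n"
proof -
  have "norm (Determinant.det A)
        \<le> (\<Sum>p | p permutes {0..<n}. norm (signof p * (\<Prod>i = 0..<n. A $$ (i, p i))))"
    unfolding det_def'[OF A] by (rule norm_sum)
  also have "\<dots> \<le> (\<Sum>p | p permutes {0..<n}. B ^ n)"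
  proof (rule sum_mono)
    fix p :: "nat \<Rightarrow> nat" assume "p \<in> {p. p permutes {0..<n}}"
    then have p: "\<And>i. i < n \<Longrightarrow> p i < n"
      by (metis (mono_tags) atLeastLessThan_iff mem_Collect_eq permutes_in_image zero_le)
    have "norm (\<Prod>i = 0..<n. A $$ (i, p i)) \<le> (\<Prod>i = 0..<n. B)"
      unfolding prod_norm[symmetric] by (rule prod_mono) (auto intro!: B p)
    then show "norm (signof p * (\<Prod>i = 0..<n. A $$ (i, p i))) \<le> B ^ n"
      by (simp add: norm_mult sign_def)
  qed
  also have "\<dots> = fact n * B ^ n"
    by (simp add: card_permutations)
  finally show ?thesis .
qed

text \<open>The extremal sets are \<open>{0..<n}\<close>. This is the source of the quadratic exponent in the
  determinant bound below.\<close>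

lemma card_choose_2_le_Sum:
  fixes S :: "nat set"
  assumes "finite S"
  shows "card S * (card S - 1) div 2 \<le> \<Sum>S"
  using assms
proof (induction "card S" arbitrary: S)
  case (Suc n)
  then have ne: "S \<noteq> {}" by auto
  have M: "Max S \<in> S" using Suc.prems ne by simp
  have "S \<subseteq> {..Max S}" using Suc.prems by auto
  then have "card S \<le> Suc (Max S)"
    by (metis card_atMost card_mono finite_atMost)
  moreover have c: "card (S - {Max S}) = n" using Suc M by simp
  moreover have "n * (n - 1) div 2 \<le> \<Sum>(S - {Max S})"
    using Suc.hyps(1)[of "S - {Max S}"] Suc.prems c by auto
  moreover have "\<Sum>S = Max S + \<Sum>(S - {Max S})"
    using Suc.prems M by (simp add: sum.remove)
  moreover have "Suc n * n div 2 = n + n * (n - 1) div 2"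
    by (cases n) auto
  ultimately show ?case unfolding Suc.hyps(2)[symmetric] by simp
qed simp

text \<open>Expanding every row into its Taylor terms writes the determinant as a sum, over all choices
  \<open>f\<close> of one exponent per row, of generalised Vandermonde determinants \<open>det (t j ^ f i)\<close>. Two equal
  exponents give two equal rows, so only injective \<open>f\<close> survive, and their exponents sum to at least
  \<open>n (n - 1) / 2\<close>. The decay \<open>(q * d) ^ m\<close> of the coefficients is split: the powers of \<open>q\<close> yield the
  gain \<open>q ^ (n (n - 1) / 2)\<close>, the powers of \<open>d\<close> make the sum over all \<open>f\<close> converge, uniformly in
  the truncation order \<open>K\<close>.\<close>

lemma interpolation_determinant_bound_finite:
  fixes a :: "nat \<Rightarrow> nat \<Rightarrow> complex" and t :: "nat \<Rightarrow> complex" and C q d :: real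
  assumes C: "0 \<le> C" and q: "0 \<le> q" "q \<le> 1" and d: "0 \<le> d" "d < 1"
    and a: "\<And>i m. i < n \<Longrightarrow> norm (a i m) \<le> C * (q * d) ^ m"
    and t: "\<And>j. j < n \<Longrightarrow> norm (t j) \<le> 1"
  shows "norm (Determinant.det (Matrix.mat n n (\<lambda>(i, j). \<Sum>m<K. a i m * t j ^ m)))
         \<le> fact n * (C / (1 - d)) ^ n * q ^ (n * (n - 1) div 2)"
proof -
  define V where "V f = Matrix.mat n n (\<lambda>(i, j). t j ^ f i)" for f :: "nat \<Rightarrow> nat"
  define I where "I = {0..<n} \<rightarrow>\<^sub>E {..<K}"
  have V: "V f \<in> carrier_mat n n" for f by (simp add: V_def)
  have "Determinant.det (Matrix.mat n n (\<lambda>(i, j). \<Sum>m<K. a i m * t j ^ m))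
        = (\<Sum>p | p permutes {0..<n}. signof p * (\<Prod>i = 0..<n. \<Sum>m<K. a i m * t (p i) ^ m))"
    by (subst det_def'[of _ n]) (auto intro!: sum.cong prod.cong dest: permutes_in_image)
  also have "\<dots> = (\<Sum>p | p permutes {0..<n}. \<Sum>f\<in>I.
                    (\<Prod>i = 0..<n. a i (f i)) * (signof p * (\<Prod>i = 0..<n. t (p i) ^ f i)))"
    unfolding I_def
    by (intro sum.cong refl, subst prod_sum_PiE)
       (auto simp: sum_distrib_left prod.distrib mult_ac)
  also have "\<dots> = (\<Sum>f\<in>I. (\<Prod>i = 0..<n. a i (f i)) *
                    (\<Sum>p | p permutes {0..<n}. signof p * (\<Prod>i = 0..<n. t (p i) ^ f i)))"
    by (subst sum.swap) (simp add: sum_distrib_left)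
  also have "\<dots> = (\<Sum>f\<in>I. (\<Prod>i = 0..<n. a i (f i)) * Determinant.det (V f))"
    unfolding det_def'[OF V]
    by (intro sum.cong refl arg_cong2[where f = "(*)"] prod.cong)
       (auto simp: V_def dest: permutes_in_image)
  finally have expand: "Determinant.det (Matrix.mat n n (\<lambda>(i, j). \<Sum>m<K. a i m * t j ^ m))
        = (\<Sum>f\<in>I. (\<Prod>i = 0..<n. a i (f i)) * Determinant.det (V f))" .
  define N where "N = n * (n - 1) div 2"
  have "norm (\<Sum>f\<in>I. (\<Prod>i = 0..<n. a i (f i)) * Determinant.det (V f))
        \<le> (\<Sum>f\<in>I. fact n * q ^ N * C ^ n * (\<Prod>i = 0..<n. d ^ f i))"
  proof (rule order_trans[OF norm_sum], rule sum_mono)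
    fix f assume "f \<in> I"
    show "norm ((\<Prod>i = 0..<n. a i (f i)) * Determinant.det (V f))
          \<le> fact n * q ^ N * C ^ n * (\<Prod>i = 0..<n. d ^ f i)"
    proof (cases "inj_on f {0..<n}")
      case False
      then obtain i j where ij: "i \<noteq> j" "i < n" "j < n" "f i = f j"
        by (auto simp: inj_on_def)
      have "row (V f) i = row (V f) j"
        using ij by (intro eq_vecI) (auto simp: V_def)
      then have "Determinant.det (V f) = 0"
        using det_identical_rows[OF V ij(1-3)] by blast
      then show ?thesis using q C d by (simp add: prod_nonneg)
    next
      case True
      have "N \<le> (\<Sum>i = 0..<n. f i)"
        using card_choose_2_le_Sum[of "f ` {0..<n}"] True
        by (simp add: card_image sum.reindex N_def)
      then have qN: "q ^ (\<Sum>i = 0..<n. f i) \<le> q ^ N"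
        using q by (intro power_decreasing) auto
      have "norm (\<Prod>i = 0..<n. a i (f i)) \<le> (\<Prod>i = 0..<n. C * (q * d) ^ f i)"
        unfolding prod_norm[symmetric] by (rule prod_mono) (auto intro: a)
      also have "\<dots> = C ^ n * q ^ (\<Sum>i = 0..<n. f i) * (\<Prod>i = 0..<n. d ^ f i)"
        by (simp add: prod.distrib power_mult_distrib power_sum)
      also have "\<dots> \<le> C ^ n * q ^ N * (\<Prod>i = 0..<n. d ^ f i)"
        using qN C d by (intro mult_right_mono mult_left_mono) (auto intro: prod_nonneg)
      finally have 1: "norm (\<Prod>i = 0..<n. a i (f i)) \<le> C ^ n * q ^ N * (\<Prod>i = 0..<n. d ^ f i)" .
      have "norm (Determinant.det (V f)) \<le> fact n * 1 ^ n"
        by (rule norm_det_le[OF V]) (auto simp: V_def norm_power intro!: power_le_one t)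
      then have "norm ((\<Prod>i = 0..<n. a i (f i)) * Determinant.det (V f))
          \<le> (C ^ n * q ^ N * (\<Prod>i = 0..<n. d ^ f i)) * fact n"
        unfolding norm_mult using 1 C q d
        by (intro mult_mono) (auto intro!: mult_nonneg_nonneg prod_nonneg)
      then show ?thesis by (simp add: mult_ac)
    qed
  qed
  also have "\<dots> = fact n * q ^ N * C ^ n * (\<Sum>m<K. d ^ m) ^ n"
    unfolding sum_distrib_left[symmetric] I_def
    by (subst prod_sum_PiE[symmetric]) auto
  also have "\<dots> \<le> fact n * q ^ N * C ^ n * (1 / (1 - d)) ^ n"
  proof (intro mult_left_mono power_mono)
    have "(\<Sum>m<K. d ^ m) \<le> (\<Sum>m. d ^ m)"
      using d by (intro sum_le_suminf summable_geometric) auto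
    then show "(\<Sum>m<K. d ^ m) \<le> 1 / (1 - d)"
      using d by (simp add: suminf_geometric)
  qed (use d q C in \<open>auto intro: sum_nonneg\<close>)
  finally show ?thesis
    unfolding expand by (simp add: power_divide N_def mult_ac)
qed

lemma tendsto_det:
  fixes A :: "nat \<Rightarrow> nat \<Rightarrow> nat \<Rightarrow> complex"
  assumes "\<And>i j. i < n \<Longrightarrow> j < n \<Longrightarrow> (\<lambda>K. A K i j) \<longlonglongrightarrow> L i j"
  shows "(\<lambda>K. Determinant.det (Matrix.mat n n (\<lambda>(i, j). A K i j)))
         \<longlonglongrightarrow> Determinant.det (Matrix.mat n n (\<lambda>(i, j). L i j))"
  unfolding det_def'[of _ n, OF mat_carrier]
  by (intro tendsto_intros) (auto dest!: permutes_in_image intro!: assms)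

text \<open>The infinite series follow from the truncations, as a determinant is continuous in its entries.\<close>

lemma interpolation_determinant_bound:
  fixes a :: "nat \<Rightarrow> nat \<Rightarrow> complex" and t :: "nat \<Rightarrow> complex" and C q d :: real
  assumes "0 \<le> C" and "0 \<le> q" "q \<le> 1" and "0 \<le> d" "d < 1"
    and "\<And>i m. i < n \<Longrightarrow> norm (a i m) \<le> C * (q * d) ^ m"
    and "\<And>j. j < n \<Longrightarrow> norm (t j) \<le> 1"
    and sums: "\<And>i j. i < n \<Longrightarrow> j < n \<Longrightarrow> (\<lambda>m. a i m * t j ^ m) sums L i j"
  shows "norm (Determinant.det (Matrix.mat n n (\<lambda>(i, j). L i j)))
         \<le> fact n * (C / (1 - d)) ^ n * q ^ (n * (n - 1) div 2)"
proof (rule LIMSEQ_le_const2)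
  show "(\<lambda>K. norm (Determinant.det (Matrix.mat n n (\<lambda>(i, j). \<Sum>m<K. a i m * t j ^ m))))
        \<longlonglongrightarrow> norm (Determinant.det (Matrix.mat n n (\<lambda>(i, j). L i j)))"
    by (intro tendsto_norm tendsto_det) (use sums in \<open>simp add: sums_def\<close>)
  show "\<exists>N. \<forall>K\<ge>N. norm (Determinant.det (Matrix.mat n n (\<lambda>(i, j). \<Sum>m<K. a i m * t j ^ m)))
          \<le> fact n * (C / (1 - d)) ^ n * q ^ (n * (n - 1) div 2)"
    using interpolation_determinant_bound_finite[where a = a and t = t and n = n, OF assms(1-7)] by blast
qed

text \<open>Gaussian elimination on a function of two variables, read on the grid of its pivot points, is
  an LU factorisation: unrolling the recursion \<open>n\<close> times expresses \<open>r 0\<close> as the sum of the removed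
  rank-one terms plus \<open>r n\<close>, and a residual vanishes on all earlier pivot rows and columns. The first
  property makes the remainder disappear on the grid, the second makes the factors triangular.\<close>

lemma elimination_determinant:
  fixes r :: "nat \<Rightarrow> 'a \<Rightarrow> 'b \<Rightarrow> complex" and x :: "nat \<Rightarrow> 'a" and y :: "nat \<Rightarrow> 'b"
  assumes pts: "\<And>k. k < n \<Longrightarrow> x k \<in> X" "\<And>k. k < n \<Longrightarrow> y k \<in> Y"
    and nz: "\<And>k. k < n \<Longrightarrow> r k (x k) (y k) \<noteq> 0"
    and step: "\<And>k u v. k < n \<Longrightarrow> u \<in> X \<Longrightarrow> v \<in> Y \<Longrightarrow>
      r (Suc k) u v = r k u v - r k (x k) v * r k u (y k) / r k (x k) (y k)"
  shows "Determinant.det (Matrix.mat n n (\<lambda>(i, j). r 0 (x i) (y j))) = (\<Prod>k<n. r k (x k) (y k))"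
proof -
  have rowz: "r k (x i) v = 0" if "i < k" "k \<le> n" "v \<in> Y" for i k v
    using that
  proof (induction k arbitrary: v)
    case (Suc k)
    show ?case
    proof (cases "i = k")
      case True
      then show ?thesis using Suc.prems step[of k "x k" v] pts[of k] nz[of k] by simp
    next
      case False
      then show ?thesis
        using Suc step[of k "x i" v] pts[of k] pts[of i] by simp
    qed
  qed simp
  have colz: "r k u (y j) = 0" if "j < k" "k \<le> n" "u \<in> X" for j k u
    using that
  proof (induction k arbitrary: u)
    case (Suc k)
    show ?case
    proof (cases "j = k")
      case True
      then show ?thesis using Suc.prems step[of k u "y k"] pts[of k] nz[of k] by simp
    next
      case False
      then show ?thesis
        using Suc step[of k u "y j"] pts[of k] pts[of j] by simp
    qed
  qed simp
  define Lm where "Lm = Matrix.mat n n (\<lambda>(i, k). r k (x i) (y k) / r k (x k) (y k))"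
  define Um where "Um = Matrix.mat n n (\<lambda>(k, j). r k (x k) (y j))"
  have carr: "Lm \<in> carrier_mat n n" "Um \<in> carrier_mat n n"
    by (simp_all add: Lm_def Um_def)
  have tele: "r 0 u v = (\<Sum>k<m. r k u (y k) / r k (x k) (y k) * r k (x k) v) + r m u v"
    if "m \<le> n" "u \<in> X" "v \<in> Y" for m u v
    using that by (induction m) (auto simp: step mult_ac)
  have "Matrix.mat n n (\<lambda>(i, j). r 0 (x i) (y j)) = Lm * Um"
  proof (rule eq_matI)
    fix i j assume "i < dim_row (Lm * Um)" "j < dim_col (Lm * Um)"
    then have ij: "i < n" "j < n" by (simp_all add: Lm_def Um_def)
    have "r n (x i) (y j) = 0" using rowz[of i n] pts ij by simp
    then have "r 0 (x i) (y j) = (\<Sum>k<n. r k (x i) (y k) / r k (x k) (y k) * r k (x k) (y j))"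
      using tele[of n "x i" "y j"] pts ij by simp
    then show "Matrix.mat n n (\<lambda>(i, j). r 0 (x i) (y j)) $$ (i, j) = (Lm * Um) $$ (i, j)"
      using ij by (simp add: Lm_def Um_def scalar_prod_def atLeast0LessThan)
  qed (simp_all add: Lm_def Um_def)
  then have "Determinant.det (Matrix.mat n n (\<lambda>(i, j). r 0 (x i) (y j)))
             = Determinant.det Lm * Determinant.det Um"
    using det_mult[OF carr] by simp
  also have "Determinant.det Lm = 1"
    by (subst det_lower_triangular[OF _ carr(1)])
       (auto simp: Lm_def prod_list_diag_prod nz rowz pts)
  also have "Determinant.det Um = (\<Prod>k<n. r k (x k) (y k))"
    by (subst det_upper_triangular[OF _ carr(2)])
       (auto simp: Um_def prod_list_diag_prod colz pts atLeast0LessThan)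
  finally show ?thesis by simp
qed

section \<open>Growth of two eliminations with a common pivot position\<close>

text \<open>\<open>P \<ge> Q\<close> bound two functions, \<open>P'\<close> and \<open>Q'\<close> bound them after one elimination step whose
  pivots have modulus \<open>P\<close> for the first and at least \<open>\<alpha> * P\<close> for the second. The larger bound alone
  may grow by the factor \<open>1 + 1/\<alpha>\<close> in such a step, but only if \<open>Q\<close> is comparable to \<open>P\<close>. For
  small \<open>\<alpha>\<close> the two bounds are far apart afterwards, so that this cannot recur at once. The product
  \<open>P * Q\<close> accounts for that: it grows by at most \<open>2 + 2/\<alpha>\<close>, which, shared evenly between the two
  functions, amounts to the square root of this number for each. Flooring the product at \<open>\<alpha> * P\<^sup>2\<close>
  keeps it comparable to \<open>P\<^sup>2\<close> even when \<open>Q\<close> is tiny,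
  without spoiling the growth factor.\<close>

lemma potential_growth_both:
  fixes \<alpha> P Q P' Q' :: real
  assumes \<alpha>: "0 < \<alpha>" "\<alpha> \<le> 1" and PQ: "0 < P" "0 \<le> Q" "Q \<le> P"
    and P': "0 \<le> P'" "P' \<le> 2 * P" and Q': "0 \<le> Q'" "Q' \<le> Q + Q\<^sup>2 / (\<alpha> * P)"
  shows "max (P' * Q') (\<alpha> * (max P' Q')\<^sup>2) \<le> (2 + 2 / \<alpha>) * max (P * Q) (\<alpha> * P\<^sup>2)"
proof -
  define x where "x = Q / P"
  have x: "0 \<le> x" "x \<le> 1" "Q = x * P" using PQ by (auto simp: x_def)
  have Q'2: "Q' \<le> x * (1 + x / \<alpha>) * P"
    using Q' PQ x(3) \<alpha> by (simp add: field_simps power2_eq_square)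
  have x\<alpha>: "x / \<alpha> \<le> 1 / \<alpha>" using x \<alpha> by (simp add: divide_right_mono)
  have PQpos: "0 \<le> P * Q" using PQ by simp
  have "P' * Q' \<le> (2 * P) * (x * (1 + x / \<alpha>) * P)"
    using P' Q' Q'2 by (intro mult_mono) auto
  also have "\<dots> = (2 * (1 + x / \<alpha>)) * (P * Q)" by (simp add: x(3) algebra_simps)
  also have "\<dots> \<le> (2 + 2 / \<alpha>) * (P * Q)"
    using x\<alpha> PQpos by (intro mult_right_mono) auto
  also have "\<dots> \<le> (2 + 2 / \<alpha>) * max (P * Q) (\<alpha> * P\<^sup>2)"
    using \<alpha> by (intro mult_left_mono) auto
  finally have 1: "P' * Q' \<le> (2 + 2 / \<alpha>) * max (P * Q) (\<alpha> * P\<^sup>2)" .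
  have "P'\<^sup>2 \<le> (2 * P)\<^sup>2" using P' by (intro power_mono) auto
  then have "\<alpha> * P'\<^sup>2 \<le> \<alpha> * (4 * P\<^sup>2)"
    using \<alpha> by (intro mult_left_mono) (auto simp: power_mult_distrib)
  also have "\<dots> = 4 * (\<alpha> * P\<^sup>2)" by simp
  also have "\<dots> \<le> (2 + 2 / \<alpha>) * (\<alpha> * P\<^sup>2)"
    using \<alpha> by (intro mult_right_mono) (auto simp: field_simps)
  also have "\<dots> \<le> (2 + 2 / \<alpha>) * max (P * Q) (\<alpha> * P\<^sup>2)"
    using \<alpha> by (intro mult_left_mono) auto
  finally have 2: "\<alpha> * P'\<^sup>2 \<le> (2 + 2 / \<alpha>) * max (P * Q) (\<alpha> * P\<^sup>2)" .
  have "Q'\<^sup>2 \<le> (x * (1 + x / \<alpha>) * P)\<^sup>2" using Q' Q'2 by (intro power_mono) auto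
  then have "\<alpha> * Q'\<^sup>2 \<le> \<alpha> * (x * (1 + x / \<alpha>) * P)\<^sup>2"
    using \<alpha> by (intro mult_left_mono) auto
  also have "\<dots> = (x * (\<alpha> + 2 * x + x * (x / \<alpha>))) * (P * Q)"
    using \<alpha> unfolding x(3) by (simp add: field_simps power2_eq_square)
  also have "\<dots> \<le> (2 + 2 / \<alpha>) * (P * Q)"
  proof (rule mult_right_mono[OF _ PQpos])
    have a: "\<alpha> \<le> 1 / \<alpha>" using \<alpha> mult_mono[of \<alpha> 1 \<alpha> 1] by (simp add: field_simps)
    have "x * (x / \<alpha>) \<le> 1 * (1 / \<alpha>)" using x x\<alpha> \<alpha> by (intro mult_mono) auto
    then have "\<alpha> + 2 * x + x * (x / \<alpha>) \<le> 2 + 2 / \<alpha>" using a x by simp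
    moreover have "x * (\<alpha> + 2 * x + x * (x / \<alpha>)) \<le> 1 * (\<alpha> + 2 * x + x * (x / \<alpha>))"
      using x \<alpha> by (intro mult_right_mono) auto
    ultimately show "x * (\<alpha> + 2 * x + x * (x / \<alpha>)) \<le> 2 + 2 / \<alpha>" by simp
  qed
  also have "\<dots> \<le> (2 + 2 / \<alpha>) * max (P * Q) (\<alpha> * P\<^sup>2)"
    using \<alpha> by (intro mult_left_mono) auto
  finally have 3: "\<alpha> * Q'\<^sup>2 \<le> (2 + 2 / \<alpha>) * max (P * Q) (\<alpha> * P\<^sup>2)" .
  show ?thesis using 1 2 3 by (auto simp: max_def)
qed

lemma potential_growth_single:
  fixes \<alpha> P Q P' Q' :: real
  assumes \<alpha>: "0 < \<alpha>" and PQ: "0 < P" "0 \<le> Q" "Q \<le> P"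
    and P': "0 \<le> P'" "P' \<le> 2 * P" and Q': "0 \<le> Q'" "Q' \<le> Q"
  shows "max (P' * Q') (\<alpha> * (max P' Q')\<^sup>2) \<le> 4 * max (P * Q) (\<alpha> * P\<^sup>2)"
proof -
  have "P' * Q' \<le> (2 * P) * Q" using assms by (intro mult_mono) auto
  moreover have "0 \<le> P * Q" using PQ by simp
  moreover have "\<alpha> * (max P' Q')\<^sup>2 \<le> \<alpha> * (2 * P)\<^sup>2"
    using assms by (intro mult_left_mono power_mono) auto
  ultimately show ?thesis by (auto simp: power_mult_distrib max_def)
qed

text \<open>Two functions \<open>r True 0\<close> and \<open>r False 0\<close> are eliminated simultaneously. The position
  \<open>(x k, y k)\<close> of the \<open>k\<close>-th pivot is common to both and maximises the larger of the two moduli; a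
  function takes part in the step only if its own pivot is at least \<open>\<alpha>\<close> times the other one. Indexing
  the functions by \<open>bool\<close> lets every statement be symmetric in them.\<close>

locale coupled_elimination =
  fixes X :: "'a set" and Y :: "'b set" and \<alpha> :: real
    and r :: "bool \<Rightarrow> nat \<Rightarrow> 'a \<Rightarrow> 'b \<Rightarrow> complex"
    and x :: "nat \<Rightarrow> 'a" and y :: "nat \<Rightarrow> 'b"
  fixes piv :: "bool \<Rightarrow> nat \<Rightarrow> complex" and active :: "bool \<Rightarrow> nat \<Rightarrow> bool" and S :: "nat \<Rightarrow> real"
  defines "piv \<equiv> \<lambda>s k. r s k (x k) (y k)"
    and "active \<equiv> \<lambda>s k. \<alpha> * norm (piv (\<not> s) k) \<le> norm (piv s k)"
    and "S \<equiv> \<lambda>k. max (norm (piv True k)) (norm (piv False k))"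
  assumes alpha: "0 < \<alpha>" "\<alpha> \<le> 1"
    and x_in: "x k \<in> X" and y_in: "y k \<in> Y"
    and norm_le_S: "u \<in> X \<Longrightarrow> v \<in> Y \<Longrightarrow> norm (r s k u v) \<le> S k"
    and S_pos: "0 < S k"
    and step_active: "active s k \<Longrightarrow> u \<in> X \<Longrightarrow> v \<in> Y \<Longrightarrow>
          r s (Suc k) u v = r s k u v - r s k (x k) v * r s k u (y k) / piv s k"
    and step_inactive: "\<not> active s k \<Longrightarrow> u \<in> X \<Longrightarrow> v \<in> Y \<Longrightarrow> r s (Suc k) u v = r s k u v"
begin

lemma norm_piv_le_S: "norm (piv s k) \<le> S k"
  by (cases s) (auto simp: S_def)

lemma active_piv_ge: "active s k \<Longrightarrow> \<alpha> * S k \<le> norm (piv s k)"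
proof -
  assume a: "active s k"
  have "\<alpha> * norm (piv s k) \<le> 1 * norm (piv s k)"
    using alpha by (intro mult_right_mono) auto
  then show ?thesis
    using a alpha unfolding S_def active_def by (cases s) (auto simp: max_def)
qed

lemma active_piv_pos: "active s k \<Longrightarrow> 0 < norm (piv s k)"
  using active_piv_ge[of s k] S_pos[of k] alpha by (smt (verit) mult_pos_pos)

lemma dominant_active: "norm (piv s k) = S k \<Longrightarrow> active s k"
proof -
  assume "norm (piv s k) = S k"
  then have "norm (piv (\<not> s) k) \<le> norm (piv s k)" using norm_piv_le_S by simp
  then have "\<alpha> * norm (piv (\<not> s) k) \<le> 1 * norm (piv s k)"
    using alpha by (intro mult_mono) auto
  then show ?thesis by (simp add: active_def)
qed

lemma ex_dominant: "\<exists>s. norm (piv s k) = S k"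
  unfolding S_def max_def by metis

definition N :: "bool \<Rightarrow> nat \<Rightarrow> real" where
  "N s k = (SUP (u, v) \<in> X \<times> Y. norm (r s k u v))"

lemma norm_le_N: "u \<in> X \<Longrightarrow> v \<in> Y \<Longrightarrow> norm (r s k u v) \<le> N s k"
  unfolding N_def
  by (rule cSUP_upper2[where x = "(u, v)"])
     (auto intro!: bdd_aboveI2[where M = "S k"] norm_le_S)

lemma N_least: "(\<And>u v. u \<in> X \<Longrightarrow> v \<in> Y \<Longrightarrow> norm (r s k u v) \<le> c) \<Longrightarrow> N s k \<le> c"
  unfolding N_def using x_in y_in by (intro cSUP_least) auto

lemma N_le_S: "N s k \<le> S k"
  by (rule N_least) (rule norm_le_S)

lemma norm_piv_le_N: "norm (piv s k) \<le> N s k"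
  unfolding piv_def by (rule norm_le_N[OF x_in y_in])

lemma N_nonneg: "0 \<le> N s k"
  using norm_piv_le_N[of s k] norm_ge_zero[of "piv s k"] by linarith

lemma S_eq_max_N: "S k = max (N s k) (N (\<not> s) k)"
proof (rule antisym)
  obtain s' where "norm (piv s' k) = S k" using ex_dominant by blast
  then show "S k \<le> max (N s k) (N (\<not> s) k)"
    using norm_piv_le_N[of s' k] by (cases s; cases s') auto
qed (simp add: N_le_S)

lemma N_step_active:
  assumes "active s k"
  shows "N s (Suc k) \<le> N s k + (N s k)\<^sup>2 / norm (piv s k)"
proof (rule N_least)
  fix u v assume uv: "u \<in> X" "v \<in> Y"
  have "norm (r s (Suc k) u v) \<le> norm (r s k u v) + norm (r s k (x k) v * r s k u (y k) / piv s k)"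
    unfolding step_active[OF assms uv] by (rule norm_triangle_ineq4)
  also have "\<dots> = norm (r s k u v) + norm (r s k (x k) v) * norm (r s k u (y k)) / norm (piv s k)"
    by (simp add: norm_mult norm_divide)
  also have "\<dots> \<le> N s k + N s k * N s k / norm (piv s k)"
    using uv x_in y_in by (intro add_mono divide_right_mono mult_mono norm_le_N N_nonneg) auto
  finally show "norm (r s (Suc k) u v) \<le> N s k + (N s k)\<^sup>2 / norm (piv s k)"
    by (simp add: power2_eq_square)
qed

lemma N_step_inactive: "\<not> active s k \<Longrightarrow> N s (Suc k) \<le> N s k"
  by (rule N_least) (simp add: step_inactive norm_le_N)

text \<open>The potential whose growth is controlled by \<open>potential_growth_both\<close> and
  \<open>potential_growth_single\<close>. It lies between \<open>\<alpha> * (S k)\<^sup>2\<close> and \<open>(S k)\<^sup>2\<close>.\<close>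

definition T :: "nat \<Rightarrow> real" where
  "T k = max (N True k * N False k) (\<alpha> * (S k)\<^sup>2)"

text \<open>The number of pivots used in step \<open>k\<close>. It measures time: the decay of the determinants and
  the growth of the potential are governed by the number of pivots, not of steps.\<close>

definition w :: "nat \<Rightarrow> nat" where
  "w k = of_bool (active True k) + of_bool (active False k)"

lemma T_eq: "T k = max (N s k * N (\<not> s) k) (\<alpha> * (max (N s k) (N (\<not> s) k))\<^sup>2)"
  unfolding T_def using S_eq_max_N[of k s] by (cases s) (auto simp: mult.commute)

lemma w_eq: "w k = of_bool (active s k) + of_bool (active (\<not> s) k)"
  by (cases s) (auto simp: w_def)

lemma w_bounds: "1 \<le> w k" "w k \<le> 2"
proof -
  obtain s where "active s k" using ex_dominant[of k] dominant_active by blast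
  then show "1 \<le> w k" using w_eq[of k s] by simp
qed (simp add: w_def)

lemma T_le: "T k \<le> (S k)\<^sup>2"
proof -
  have "N True k * N False k \<le> S k * S k"
    using N_nonneg S_pos[of k] by (intro mult_mono N_le_S) auto
  moreover have "\<alpha> * (S k)\<^sup>2 \<le> 1 * (S k)\<^sup>2"
    using alpha by (intro mult_right_mono) auto
  ultimately show ?thesis by (simp add: T_def power2_eq_square)
qed

text \<open>The dominant function, the one whose pivot has modulus \<open>S k\<close>, is always active and at most
  doubles. So a step with one pivot multiplies the potential by at most \<open>4\<close>, and one with two pivots by
  at most \<open>2 + 2/\<alpha>\<close>; in both cases this is \<open>g\<^sup>2\<close> per pivot.\<close>

lemma T_step:
  assumes g: "4 \<le> g\<^sup>2" "2 + 2 / \<alpha> \<le> g ^ 4"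
  shows "T (Suc k) \<le> g ^ (2 * w k) * T k"
proof -
  obtain s where s: "norm (piv s k) = S k" using ex_dominant by blast
  define P where "P = N s k"
  define Q where "Q = N (\<not> s) k"
  have PS: "P = S k" unfolding P_def
    using norm_piv_le_N[of s k] N_le_S[of s k] s by simp
  have P: "0 < P" using PS S_pos by simp
  have Q: "0 \<le> Q" "Q \<le> P" unfolding PS Q_def by (rule N_nonneg, rule N_le_S)
  have Tk: "T k = max (P * Q) (\<alpha> * P\<^sup>2)"
    using T_eq[of k s] Q by (simp add: P_def Q_def max_def)
  have act: "active s k" using dominant_active[OF s] .
  have P': "N s (Suc k) \<le> 2 * P"
    using N_step_active[OF act] P unfolding s PS[symmetric] P_def[symmetric]
    by (simp add: power2_eq_square)
  have Tk0: "0 \<le> T k" unfolding T_def using alpha by (simp add: le_max_iff_disj)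
  show ?thesis
  proof (cases "active (\<not> s) k")
    case True
    have "N (\<not> s) (Suc k) \<le> Q + Q\<^sup>2 / norm (piv (\<not> s) k)"
      using N_step_active[OF True] by (simp add: Q_def)
    also have "\<dots> \<le> Q + Q\<^sup>2 / (\<alpha> * P)"
      using active_piv_ge[OF True] alpha P
      by (intro add_mono divide_left_mono mult_pos_pos active_piv_pos[OF True]) (auto simp: PS)
    finally have "T (Suc k) \<le> (2 + 2 / \<alpha>) * T k"
      unfolding T_eq[of "Suc k" s] Tk
      by (intro potential_growth_both alpha P Q P' N_nonneg)
    also have "\<dots> \<le> g ^ 4 * T k" using g Tk0 by (intro mult_right_mono)
    finally show ?thesis using act True w_eq[of k s] by simp
  next
    case False
    have "N (\<not> s) (Suc k) \<le> Q"
      using N_step_inactive[OF False] by (simp add: Q_def)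
    then have "T (Suc k) \<le> 4 * T k"
      unfolding T_eq[of "Suc k" s] Tk
      by (intro potential_growth_single alpha P Q P' N_nonneg)
    also have "\<dots> \<le> g\<^sup>2 * T k" using g Tk0 by (intro mult_right_mono)
    finally show ?thesis using act False w_eq[of k s] by simp
  qed
qed

definition W :: "nat \<Rightarrow> nat" where "W K = (\<Sum>k<K. w k)"

lemma W_mono: "j \<le> K \<Longrightarrow> W j \<le> W K"
  unfolding W_def by (rule sum_mono2) auto

lemma W_ge: "K \<le> W K"
  unfolding W_def using sum_mono[of "{..<K}" "\<lambda>_. 1" w] w_bounds by simp

lemma T_growth:
  assumes g: "4 \<le> g\<^sup>2" "2 + 2 / \<alpha> \<le> g ^ 4" and "j \<le> K"
  shows "T K \<le> g ^ (2 * (W K - W j)) * T j"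
  using \<open>j \<le> K\<close>
proof (induction K rule: dec_induct)
  case (step K)
  have W: "W (Suc K) - W j = w K + (W K - W j)"
    using W_mono[OF step.hyps(1)] by (simp add: W_def)
  have "T (Suc K) \<le> g ^ (2 * w K) * T K" by (rule T_step[OF g])
  also have "\<dots> \<le> g ^ (2 * w K) * (g ^ (2 * (W K - W j)) * T j)"
    using step.IH by (intro mult_left_mono) (auto simp: power_mult)
  finally show ?case unfolding W by (simp add: power_add algebra_simps)
qed simp

text \<open>The numbers \<open>w j\<close> are the increments of \<open>W\<close>, so the sum approximates the integral of
  \<open>W K - x\<close> over \<open>0 \<le> x \<le> W K\<close>. The linear correction uses
  \<open>w j \<le> 2\<close>.\<close>

lemma weight_sum_le: "2 * (\<Sum>j<K. w j * (W K - W j)) \<le> (W K)\<^sup>2 + 2 * W K"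
proof (induction K)
  case (Suc K)
  have "(\<Sum>j<K. w j * (W (Suc K) - W j)) = (\<Sum>j<K. w j * (W K - W j) + w j * w K)"
  proof (rule sum.cong[OF refl])
    fix j assume "j \<in> {..<K}"
    then have "W j \<le> W K" by (intro W_mono) simp
    then have "W (Suc K) - W j = (W K - W j) + w K" by (simp add: W_def)
    then show "w j * (W (Suc K) - W j) = w j * (W K - W j) + w j * w K"
      by (simp only: distrib_left)
  qed
  also have "\<dots> = (\<Sum>j<K. w j * (W K - W j)) + W K * w K"
    by (simp add: sum.distrib sum_distrib_right W_def)
  finally have "2 * (\<Sum>j<Suc K. w j * (W (Suc K) - W j))
      = 2 * (\<Sum>j<K. w j * (W K - W j)) + 2 * (W K * w K) + 2 * (w K * w K)"
    by (simp add: W_def)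
  also have "\<dots> \<le> (W K)\<^sup>2 + 2 * W K + 2 * (W K * w K) + 2 * (w K * w K)"
    using Suc.IH by simp
  also have "\<dots> \<le> (W K + w K)\<^sup>2 + 2 * (W K + w K)"
    using mult_right_mono[OF w_bounds(2), of "w K" K]
    by (simp add: power2_eq_square algebra_simps)
  finally show ?case by (simp add: W_def)
qed (simp add: W_def)

definition steps :: "bool \<Rightarrow> nat \<Rightarrow> nat" where
  "steps s K = card {k. k < K \<and> active s k}"

lemma Collect_less_Suc: "{k. k < Suc K \<and> active s k} =
   (if active s K then insert K {k. k < K \<and> active s k} else {k. k < K \<and> active s k})"
  by (auto simp: less_Suc_eq)

lemma steps_sum: "steps True K + steps False K = W K"
  by (induction K) (auto simp: steps_def W_def w_def Collect_less_Suc)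

text \<open>Inactive steps leave the function unchanged, so the active steps alone form an elimination
  to which \<open>elimination_determinant\<close> applies.\<close>

lemma active_pivots_are_determinant:
  "\<exists>x' y'. (\<forall>i<steps s K. x' i \<in> X \<and> y' i \<in> Y) \<and>
     Determinant.det (Matrix.mat (steps s K) (steps s K) (\<lambda>(i, j). r s 0 (x' i) (y' j)))
       = (\<Prod>k | k < K \<and> active s k. piv s k)"
proof -
  have "\<exists>x' y' r'. (\<forall>i<steps s K. x' i \<in> X \<and> y' i \<in> Y) \<and> r' 0 = r s 0 \<and>
     (\<forall>u\<in>X. \<forall>v\<in>Y. r' (steps s K) u v = r s K u v) \<and>
     (\<forall>k<steps s K. r' k (x' k) (y' k) \<noteq> 0 \<and> (\<forall>u\<in>X. \<forall>v\<in>Y.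
        r' (Suc k) u v = r' k u v - r' k (x' k) v * r' k u (y' k) / r' k (x' k) (y' k))) \<and>
     (\<Prod>k<steps s K. r' k (x' k) (y' k)) = (\<Prod>k | k < K \<and> active s k. piv s k)"
  proof (induction K)
    case 0
    show ?case
      by (rule exI, rule exI, rule exI[of _ "\<lambda>_. r s 0"]) (auto simp: steps_def)
  next
    case (Suc K)
    show ?case
    proof (cases "active s K")
      case False
      then have *: "{k. k < Suc K \<and> active s k} = {k. k < K \<and> active s k}"
        "steps s (Suc K) = steps s K"
        by (auto simp: Collect_less_Suc steps_def)
      show ?thesis
        using Suc.IH unfolding * by (simp add: step_inactive[OF False] cong: ball_cong)
    next
      case True
      then have *: "{k. k < Suc K \<and> active s k} = insert K {k. k < K \<and> active s k}"
        "steps s (Suc K) = Suc (steps s K)"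
        by (auto simp: Collect_less_Suc steps_def)
      define n where "n = steps s K"
      from Suc.IH[folded n_def] obtain x' y' r' where
        pts: "\<forall>i<n. x' i \<in> X \<and> y' i \<in> Y" and r0: "r' 0 = r s 0"
        and rn: "\<And>u v. u \<in> X \<Longrightarrow> v \<in> Y \<Longrightarrow> r' n u v = r s K u v"
        and st: "\<forall>k<n. r' k (x' k) (y' k) \<noteq> 0 \<and> (\<forall>u\<in>X. \<forall>v\<in>Y.
          r' (Suc k) u v = r' k u v - r' k (x' k) v * r' k u (y' k) / r' k (x' k) (y' k))"
        and pr: "(\<Prod>k<n. r' k (x' k) (y' k)) = (\<Prod>k | k < K \<and> active s k. piv s k)"
        by blast
      have pivK: "r' n (x K) (y K) = piv s K"
        by (simp add: rn x_in y_in piv_def)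
      show ?thesis unfolding * n_def[symmetric]
      proof (rule exI[of _ "x'(n := x K)"], rule exI[of _ "y'(n := y K)"],
          rule exI[of _ "r'(Suc n := r s (Suc K))"], intro conjI)
        show "\<forall>k<Suc n. (r'(Suc n := r s (Suc K))) k ((x'(n := x K)) k) ((y'(n := y K)) k) \<noteq> 0 \<and>
          (\<forall>u\<in>X. \<forall>v\<in>Y. (r'(Suc n := r s (Suc K))) (Suc k) u v =
             (r'(Suc n := r s (Suc K))) k u v
             - (r'(Suc n := r s (Suc K))) k ((x'(n := x K)) k) v
               * (r'(Suc n := r s (Suc K))) k u ((y'(n := y K)) k)
               / (r'(Suc n := r s (Suc K))) k ((x'(n := x K)) k) ((y'(n := y K)) k))"
          using st active_piv_pos[OF True] x_in y_in
          by (auto simp: less_Suc_eq pivK rn step_active[OF True])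
        show "(\<Prod>k<Suc n. (r'(Suc n := r s (Suc K))) k ((x'(n := x K)) k) ((y'(n := y K)) k))
              = (\<Prod>k\<in>insert K {k. k < K \<and> active s k}. piv s k)"
          using pr by (simp add: pivK mult.commute)
      qed (use pts r0 x_in y_in in \<open>auto simp: less_Suc_eq\<close>)
    qed
  qed
  then obtain x' y' r' where *: "\<forall>i<steps s K. x' i \<in> X \<and> y' i \<in> Y" "r' 0 = r s 0"
     "\<forall>k<steps s K. r' k (x' k) (y' k) \<noteq> 0 \<and> (\<forall>u\<in>X. \<forall>v\<in>Y.
        r' (Suc k) u v = r' k u v - r' k (x' k) v * r' k u (y' k) / r' k (x' k) (y' k))"
     "(\<Prod>k<steps s K. r' k (x' k) (y' k)) = (\<Prod>k | k < K \<and> active s k. piv s k)"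
    by blast
  have "Determinant.det (Matrix.mat (steps s K) (steps s K) (\<lambda>(i, j). r' 0 (x' i) (y' j)))
        = (\<Prod>k<steps s K. r' k (x' k) (y' k))"
    by (rule elimination_determinant[where X = X and Y = Y]) (use * in auto)
  then show ?thesis using * by auto
qed

text \<open>Two estimates of the product of all pivots used before step \<open>K\<close> are compared. By the
  determinant bound it decays like \<open>h\<close> to the power \<open>- V\<^sup>2 / 2\<close>, where \<open>V = W K\<close> is the number of those
  pivots: the exponent \<open>n\<^sup>2 + n'\<^sup>2\<close> for numbers \<open>n + n' = V\<close> of pivots of the two functions is least
  when \<open>n = n'\<close>. Since the potential is multiplied by at most \<open>g\<^sup>2\<close> per pivot, \<open>S j\<close> for
  \<open>j < K\<close> cannot be much smaller than \<open>S K\<close>, and the product is at least of order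
  \<open>(S K) ^ V\<close> times \<open>g\<close> to the power \<open>- V\<^sup>2 / 2\<close>. Everything is
  squared to keep the exponents integral, and the claim is the \<open>V\<close>-th root of the comparison.\<close>

lemma S_quadratic_exponent_bound:
  fixes g h D :: real
  assumes g: "2 \<le> g" "2 + 2 / \<alpha> \<le> g ^ 4" and h: "1 \<le> h" and D: "0 \<le> D"
    and det: "\<And>s n x' y'. (\<And>i. i < n \<Longrightarrow> x' i \<in> X) \<Longrightarrow> (\<And>i. i < n \<Longrightarrow> y' i \<in> Y) \<Longrightarrow>
      norm (Determinant.det (Matrix.mat n n (\<lambda>(i, j). r s 0 (x' i) (y' j))))
        \<le> fact n * D ^ n / h ^ (n * (n - 1))"
    and K: "0 < K"
  shows "\<alpha> ^ 3 * (S K)\<^sup>2 * h ^ W K \<le> g ^ (W K + 2) * (real (W K) * D)\<^sup>2 * h\<^sup>2"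
proof -
  define n where "n s = steps s K" for s
  define V where "V = W K"
  have V: "n True + n False = V" unfolding n_def V_def by (rule steps_sum)
  have Vpos: "0 < V" using W_ge[of K] K by (simp add: V_def)
  have g4: "4 \<le> g\<^sup>2" using g power_mono[of 2 g 2] by simp
  have gpos: "0 < g" using g by simp
  have actS: "{k. k < K \<and> active s k} = {k \<in> {..<K}. active s k}" for s by auto
  have up: "(\<Prod>k<K. (\<alpha> * S k) ^ of_bool (active s k)) * h ^ (n s * (n s - 1)) \<le> (real V * D) ^ n s"
    for s
  proof -
    obtain x' y' where xy: "\<forall>i<n s. x' i \<in> X \<and> y' i \<in> Y"
       "Determinant.det (Matrix.mat (n s) (n s) (\<lambda>(i, j). r s 0 (x' i) (y' j)))
       = (\<Prod>k | k < K \<and> active s k. piv s k)"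
      using active_pivots_are_determinant[of s K] unfolding n_def by blast
    have "(\<Prod>k<K. (\<alpha> * S k) ^ of_bool (active s k)) = (\<Prod>k | k < K \<and> active s k. \<alpha> * S k)"
      unfolding actS by (subst prod.inter_filter) (auto intro!: prod.cong)
    also have "\<dots> \<le> (\<Prod>k | k < K \<and> active s k. norm (piv s k))"
      using alpha less_imp_le[OF S_pos] by (intro prod_mono) (auto intro: active_piv_ge)
    also have "\<dots> \<le> fact (n s) * D ^ n s / h ^ (n s * (n s - 1))"
      unfolding prod_norm xy(2)[symmetric] using xy(1) by (intro det) auto
    also have "\<dots> \<le> (real V * D) ^ n s / h ^ (n s * (n s - 1))"
    proof (rule divide_right_mono)
      have "n s \<le> V" using V by (cases s) auto
      then have "real (n s) ^ n s \<le> real V ^ n s" by (intro power_mono) auto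
      moreover have "fact (n s) \<le> real (n s) ^ n s"
        using fact_le_power[of "n s"] by simp
      ultimately show "fact (n s) * D ^ n s \<le> (real V * D) ^ n s"
        using D by (auto simp: power_mult_distrib intro!: mult_right_mono)
    qed (use h in auto)
    finally show ?thesis using h by (simp add: pos_le_divide_eq)
  qed
  \<comment> \<open>\<open>Z\<close> is a lower bound for the modulus of the product of all pivots before step \<open>K\<close>.\<close>
  define Z where "Z = (\<Prod>k<K. (\<alpha> * S k) ^ w k)"
  have Z: "Z = (\<Prod>k<K. (\<alpha> * S k) ^ of_bool (active True k)) *
               (\<Prod>k<K. (\<alpha> * S k) ^ of_bool (active False k))"
    unfolding Z_def by (simp add: w_def power_add prod.distrib)
  have Z0: "0 \<le> Z" unfolding Z_def using alpha S_pos by (intro prod_nonneg) (simp add: less_imp_le)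
  \<comment> \<open>\<open>E\<close> is the total exponent of \<open>h\<close> in the two determinant bounds; it is about \<open>V\<^sup>2 / 2\<close>.\<close>
  define E where "E = n True * (n True - 1) + n False * (n False - 1)"
  have "Z * h ^ E = ((\<Prod>k<K. (\<alpha> * S k) ^ of_bool (active True k)) * h ^ (n True * (n True - 1))) *
      ((\<Prod>k<K. (\<alpha> * S k) ^ of_bool (active False k)) * h ^ (n False * (n False - 1)))"
    by (simp add: Z E_def power_add mult_ac)
  also have "\<dots> \<le> (real V * D) ^ n True * (real V * D) ^ n False"
    using alpha less_imp_le[OF S_pos] h D
    by (intro mult_mono up) (auto intro!: mult_nonneg_nonneg prod_nonneg)
  also have "\<dots> = (real V * D) ^ V" by (simp add: power_add[symmetric] V)
  finally have upper: "Z * h ^ E \<le> (real V * D) ^ V" .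
  have VE: "V\<^sup>2 \<le> 2 * E + 2 * V"
  proof -
    have e: "m * (m - 1) + m = m\<^sup>2" for m :: nat by (cases m) (auto simp: power2_eq_square)
    have "2 * E + 2 * V = 2 * ((n True)\<^sup>2 + (n False)\<^sup>2)"
      unfolding E_def V[symmetric] e[symmetric] by simp
    moreover have "(a + b)\<^sup>2 \<le> 2 * (a\<^sup>2 + b\<^sup>2)" for a b :: nat
    proof -
      have "0 \<le> (real a - real b)\<^sup>2" by simp
      then have "(real a + real b)\<^sup>2 \<le> 2 * ((real a)\<^sup>2 + (real b)\<^sup>2)"
        by (simp add: power2_eq_square algebra_simps)
      then show ?thesis by (metis (mono_tags) of_nat_add of_nat_le_iff of_nat_mult of_nat_numeral of_nat_power)
    qed
    ultimately show ?thesis unfolding V[symmetric] by simp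
  qed
  define c where "c = \<alpha> ^ 3 * (S K)\<^sup>2"
  have c0: "0 \<le> c" unfolding c_def using alpha by simp
  \<comment> \<open>Going back from \<open>K\<close> to \<open>j\<close> the potential loses a factor of at most \<open>g\<^sup>2\<close>
    for each of the \<open>V - W j\<close> pivots in between.\<close>
  have low: "c \<le> (\<alpha> * S j)\<^sup>2 * g ^ (2 * (V - W j))" if "j < K" for j
  proof -
    have "\<alpha> * (S K)\<^sup>2 \<le> T K" by (simp add: T_def)
    also have "\<dots> \<le> g ^ (2 * (V - W j)) * T j"
      unfolding V_def using that by (intro T_growth g4 g) auto
    also have "\<dots> \<le> g ^ (2 * (V - W j)) * (S j)\<^sup>2"
      using gpos by (intro mult_left_mono T_le) auto
    finally have "\<alpha>\<^sup>2 * (\<alpha> * (S K)\<^sup>2) \<le> \<alpha>\<^sup>2 * (g ^ (2 * (V - W j)) * (S j)\<^sup>2)"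
      by (intro mult_left_mono) auto
    then show ?thesis by (simp add: c_def power_mult_distrib eval_nat_numeral mult_ac)
  qed
  have "c ^ V = (\<Prod>j<K. c ^ w j)" by (simp add: V_def W_def power_sum)
  also have "\<dots> \<le> (\<Prod>j<K. ((\<alpha> * S j)\<^sup>2 * g ^ (2 * (V - W j))) ^ w j)"
    using c0 low by (intro prod_mono) (auto intro: power_mono)
  also have "\<dots> = Z\<^sup>2 * g ^ (2 * (\<Sum>j<K. w j * (V - W j)))"
    by (simp add: Z_def power_mult_distrib prod.distrib prod_power_distrib power_sum sum_distrib_left
        flip: power_mult) (simp add: mult_ac)
  also have "\<dots> \<le> Z\<^sup>2 * g ^ (V\<^sup>2 + 2 * V)"
    using weight_sum_le[of K] g by (intro mult_left_mono power_increasing) (auto simp: V_def)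
  finally have lower: "c ^ V \<le> Z\<^sup>2 * g ^ (V\<^sup>2 + 2 * V)" .
  have "(c * h ^ V) ^ V = c ^ V * h ^ V\<^sup>2"
    by (simp add: power_mult_distrib power_mult[symmetric] power2_eq_square)
  also have "\<dots> \<le> (Z\<^sup>2 * g ^ (V\<^sup>2 + 2 * V)) * h ^ (2 * E + 2 * V)"
    using lower VE h c0 gpos by (intro mult_mono power_increasing) auto
  also have "\<dots> = (Z * h ^ E)\<^sup>2 * (g ^ (V\<^sup>2 + 2 * V) * h ^ (2 * V))"
    by (simp add: power_mult_distrib power_add power_mult mult_ac power2_eq_square)
  also have "\<dots> \<le> ((real V * D) ^ V)\<^sup>2 * (g ^ (V\<^sup>2 + 2 * V) * h ^ (2 * V))"
    using upper Z0 h gpos by (intro mult_right_mono power_mono) auto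
  also have "\<dots> = (g ^ (V + 2) * (real V * D)\<^sup>2 * h\<^sup>2) ^ V"
  proof -
    have "V\<^sup>2 + 2 * V = (V + 2) * V" by (simp add: power2_eq_square)
    then have "((real V * D) ^ V)\<^sup>2 * (g ^ (V\<^sup>2 + 2 * V) * h ^ (2 * V))
        = ((real V * D)\<^sup>2) ^ V * ((g ^ (V + 2)) ^ V * (h\<^sup>2) ^ V)"
      by (simp only: power_mult[symmetric] mult.commute[of V 2])
    then show ?thesis by (simp only: power_mult_distrib[of _ _ V] mult_ac)
  qed
  finally have "c * h ^ V \<le> g ^ (V + 2) * (real V * D)\<^sup>2 * h\<^sup>2"
    by (subst (asm) power_mono_iff) (use c0 h gpos Vpos in auto)
  then show ?thesis by (simp add: c_def V_def)
qed

text \<open>Up to constants the preceding bound is \<open>(S K)\<^sup>2 \<le> W\<^sup>2 (g / h) ^ W\<close> with \<open>W = W K \<ge> K\<close>, so the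
  decay of the determinants beats the growth of the potential as soon as \<open>g < h\<close>.\<close>

lemma S_tendsto_0:
  fixes g h D :: real
  assumes g: "2 \<le> g" "2 + 2 / \<alpha> \<le> g ^ 4" and h: "g < h" and D: "0 \<le> D"
    and det: "\<And>s n x' y'. (\<And>i. i < n \<Longrightarrow> x' i \<in> X) \<Longrightarrow> (\<And>i. i < n \<Longrightarrow> y' i \<in> Y) \<Longrightarrow>
      norm (Determinant.det (Matrix.mat n n (\<lambda>(i, j). r s 0 (x' i) (y' j))))
        \<le> fact n * D ^ n / h ^ (n * (n - 1))"
  shows "S \<longlonglongrightarrow> 0"
proof -
  define z where "z = sqrt (g / h)"
  have z: "norm z < 1" "z\<^sup>2 = g / h" using g h by (auto simp: z_def)
  have "(\<lambda>n. (real n * z ^ n)\<^sup>2) \<longlonglongrightarrow> 0\<^sup>2"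
    by (intro tendsto_power powser_times_n_limit_0 z)
  moreover have "filterlim W sequentially sequentially"
    by (rule filterlim_at_top_mono[OF filterlim_ident]) (simp add: W_ge)
  ultimately have "(\<lambda>K. (real (W K) * z ^ W K)\<^sup>2) \<longlonglongrightarrow> 0"
    using filterlim_compose by force
  then have lim: "(\<lambda>K. (g\<^sup>2 * D\<^sup>2 * h\<^sup>2 / \<alpha> ^ 3) * (real (W K) * z ^ W K)\<^sup>2) \<longlonglongrightarrow> 0"
    by (rule tendsto_mult_right_zero)
  have "(S K)\<^sup>2 \<le> (g\<^sup>2 * D\<^sup>2 * h\<^sup>2 / \<alpha> ^ 3) * (real (W K) * z ^ W K)\<^sup>2" if "0 < K" for K
  proof -
    have hp: "0 < h" using g h by simp
    have "(real (W K) * z ^ W K)\<^sup>2 = (real (W K))\<^sup>2 * (z\<^sup>2) ^ W K"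
      by (simp add: power_mult_distrib mult.commute flip: power_mult)
    also have "\<dots> = (real (W K))\<^sup>2 * g ^ W K / h ^ W K"
      by (simp add: z power_divide)
    finally have *: "(real (W K) * z ^ W K)\<^sup>2 = (real (W K))\<^sup>2 * g ^ W K / h ^ W K" .
    have "\<alpha> ^ 3 * (S K)\<^sup>2 * h ^ W K \<le> g ^ (W K + 2) * (real (W K) * D)\<^sup>2 * h\<^sup>2"
      by (rule S_quadratic_exponent_bound[OF g _ D det that]) (use g h in auto)
    then show ?thesis
      unfolding * using alpha hp
      by (simp add: field_simps power2_eq_square power_mult_distrib)
  qed
  then have "(\<lambda>K. (S K)\<^sup>2) \<longlonglongrightarrow> 0"
    by (intro tendsto_sandwich[OF _ _ tendsto_const lim])
       (auto intro!: eventually_sequentiallyI[of 1])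
  then have "(\<lambda>K. sqrt ((S K)\<^sup>2)) \<longlonglongrightarrow> sqrt 0" by (rule tendsto_real_sqrt)
  then show ?thesis using S_pos by (simp add: less_imp_le)
qed

end

section \<open>Decoupling the structure-preserving elimination\<close>

text \<open>The sum and the difference are the coordinates that diagonalise all matrices
  \<open>pivot_mat a b\<close> simultaneously. Only the arguments \<open>(l, t) \<in> [0,\<pi>]\<^sup>2\<close> are meaningful.\<close>

definition mode :: "bool \<Rightarrow> (real \<Rightarrow> real \<Rightarrow> complex) \<Rightarrow> real \<Rightarrow> real \<Rightarrow> complex" where
  "mode s e l t = e (l - pi) t + (if s then e l t else - e l t)"

text \<open>The diagonal entries \<open>m\<^sup>+\<close> (for \<open>True\<close>) and \<open>m\<^sup>-\<close> (for \<open>False\<close>) of the pseudoinverse in the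
  diagonalising coordinates, see \<open>GE_update_modes\<close>. For \<open>\<alpha> \<le> 1\<close> the three-way case distinction
  amounts to one independent test for each entry.\<close>

definition mode_coeff :: "real \<Rightarrow> bool \<Rightarrow> (real \<Rightarrow> real \<Rightarrow> complex) \<Rightarrow> real \<Rightarrow> real \<Rightarrow> complex" where
  "mode_coeff \<alpha> s e l t =
     (if \<alpha> * norm (mode (\<not> s) e l t) \<le> norm (mode s e l t) then 1 / mode s e l t else 0)"

text \<open>The form of block-mirror-centrosymmetry that is used and preserved by the elimination:
  reflecting \<open>\<theta>\<close> is the same as shifting \<open>\<lambda>\<close> by \<open>\<pi>\<close>.\<close>

definition glide_symmetric :: "(real \<Rightarrow> real \<Rightarrow> complex) \<Rightarrow> bool" where
  "glide_symmetric e \<longleftrightarrow>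
     (\<forall>l\<in>{0..pi}. \<forall>t\<in>{0..pi}. e l (- t) = e (l - pi) t \<and> e (l - pi) (- t) = e l t)"

lemma BMC_imp_glide_symmetric: "BMC f \<Longrightarrow> glide_symmetric f"
proof -
  assume "BMC f"
  then obtain g h where *:
    "\<forall>l\<in>{-pi..0}. \<forall>t\<in>{0..pi}. f l t = g (l + pi) t"
    "\<forall>l\<in>{0..pi}. \<forall>t\<in>{0..pi}. f l t = h l t"
    "\<forall>l\<in>{0..pi}. \<forall>t\<in>{-pi..0}. f l t = g l (- t)"
    "\<forall>l\<in>{-pi..0}. \<forall>t\<in>{-pi..0}. f l t = h (l + pi) (- t)"
    unfolding BMC_def by blast
  show "glide_symmetric f"
    unfolding glide_symmetric_def using * by auto
qed

lemma sigma1_pivot_at: "sigma1 (pivot_at e l t) = max (norm (mode True e l t)) (norm (mode False e l t))"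
  by (simp add: sigma1_def pivot_at_def pivot_mat_def mode_def)

lemma GE_update_modes:
  assumes \<alpha>: "0 < \<alpha>" "\<alpha> \<le> 1"
  shows "GE_update \<alpha> e l0 t0 l t =
    (mode_coeff \<alpha> True e l0 t0 * (e (l0 - pi) t + e l0 t) * (e l t0 + e l (- t0)) +
     mode_coeff \<alpha> False e l0 t0 * (e (l0 - pi) t - e l0 t) * (e l t0 - e l (- t0))) / 2"
proof -
  define a where "a = e (l0 - pi) t0"
  define b where "b = e l0 t0"
  have contract: "\<alpha> * norm z \<le> norm z" for z :: complex
    using \<alpha> by (simp add: mult_left_le_one_le)
  have mp: "mode_coeff \<alpha> True e l0 t0 = (if cmod (a - b) < \<alpha> * cmod (a + b) then 1 / (a + b)
      else if cmod (a + b) < \<alpha> * cmod (a - b) then 0 else 1 / (a + b))"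
    using contract[of "a + b"] contract[of "a - b"]
    by (auto simp: mode_coeff_def mode_def a_def b_def)
  have mm: "mode_coeff \<alpha> False e l0 t0 = (if cmod (a - b) < \<alpha> * cmod (a + b) then 0
      else if cmod (a + b) < \<alpha> * cmod (a - b) then 1 / (a - b) else 1 / (a - b))"
    using contract[of "a + b"] contract[of "a - b"]
    by (auto simp: mode_coeff_def mode_def a_def b_def)
  have "pinv \<alpha> (pivot_at e l0 t0) = Finite_Cartesian_Product.mat (1/2) ** hadamard2 **
     vector [vector [mode_coeff \<alpha> True e l0 t0, 0], vector [0, mode_coeff \<alpha> False e l0 t0]] ** hadamard2"
    unfolding pinv_def mp mm
    by (simp add: pivot_at_def pivot_mat_def Let_def flip: a_def b_def)
  then show ?thesis
    unfolding GE_update_def Let_def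
    by (simp add: matrix_matrix_mult_def matrix_vector_mult_def sum_2 hadamard2_def
        Finite_Cartesian_Product.mat_def field_simps)
qed

context
  fixes \<alpha> :: real and e :: "real \<Rightarrow> real \<Rightarrow> complex" and l0 t0 :: real
  assumes \<alpha>: "0 < \<alpha>" "\<alpha> \<le> 1" and sym: "glide_symmetric e"
    and l0: "l0 \<in> {0..pi}" and t0: "t0 \<in> {0..pi}"
begin

text \<open>By the symmetry the row and column vectors of the update become, in the diagonalising
  coordinates, the two modes up to sign; the sign of the difference mode depends on the half of the
  interval in which the argument lies. So the update is itself
  symmetric and its modes are rank-one terms built from the same mode of \<open>e\<close>.\<close>

lemma GE_update_values:
  assumes l: "l \<in> {0..pi}" and t: "t \<in> {0..pi}"
  defines "A \<equiv> mode_coeff \<alpha> True e l0 t0 * mode True e l0 t * mode True e l t0"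
    and "B \<equiv> mode_coeff \<alpha> False e l0 t0 * mode False e l0 t * mode False e l t0"
  shows "GE_update \<alpha> e l0 t0 (l - pi) t = (A + B) / 2"
    and "GE_update \<alpha> e l0 t0 l t = (A - B) / 2"
    and "GE_update \<alpha> e l0 t0 (l - pi) (- t) = (A - B) / 2"
    and "GE_update \<alpha> e l0 t0 l (- t) = (A + B) / 2"
  unfolding GE_update_modes[OF \<alpha>] A_def B_def
  using sym l t l0 t0 by (simp_all add: glide_symmetric_def mode_def algebra_simps add_divide_distrib)

lemma GE_step_mode:
  assumes "\<And>l t. l \<in> {-pi..pi} \<Longrightarrow> t \<in> {-pi..pi} \<Longrightarrow> e' l t = e l t - GE_update \<alpha> e l0 t0 l t"
    and "l \<in> {0..pi}" and "t \<in> {0..pi}"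
  shows "mode s e' l t = mode s e l t - mode_coeff \<alpha> s e l0 t0 * mode s e l0 t * mode s e l t0"
proof -
  have "mode s e' l t = mode s e l t
     - (if s then GE_update \<alpha> e l0 t0 (l - pi) t + GE_update \<alpha> e l0 t0 l t
        else GE_update \<alpha> e l0 t0 (l - pi) t - GE_update \<alpha> e l0 t0 l t)"
    using assms by (simp add: mode_def[of s e'] mode_def[of s e])
  moreover have "(A + B) / 2 + (A - B) / 2 = A" "(A + B) / 2 - (A - B) / 2 = B" for A B :: complex
    by (simp_all add: field_simps)
  ultimately show ?thesis
    by (cases s) (simp_all only: GE_update_values(1,2)[OF assms(2,3)] if_True if_False)
qed

lemma GE_step_glide_symmetric:
  assumes "\<And>l t. l \<in> {-pi..pi} \<Longrightarrow> t \<in> {-pi..pi} \<Longrightarrow> e' l t = e l t - GE_update \<alpha> e l0 t0 l t"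
  shows "glide_symmetric e'"
  using sym assms unfolding glide_symmetric_def by (auto simp: GE_update_values)

end

text \<open>Every point of the large square is the image of a point of \<open>[0,\<pi>]\<^sup>2\<close> under the symmetry, and
  there the values are half the sum or difference of the modes.\<close>

lemma norm_le_of_modes:
  assumes sym: "glide_symmetric e" and l: "l \<in> {-pi..pi}" and t: "t \<in> {-pi..pi}"
    and c: "\<And>s l t. l \<in> {0..pi} \<Longrightarrow> t \<in> {0..pi} \<Longrightarrow> norm (mode s e l t) \<le> c"
  shows "norm (e l t) \<le> c"
proof -
  have *: "norm (e (l - pi) t) \<le> c \<and> norm (e l t) \<le> c" if "l \<in> {0..pi}" "t \<in> {0..pi}" for l t
  proof -
    have "e (l - pi) t = (mode True e l t + mode False e l t) / 2"
      "e l t = (mode True e l t - mode False e l t) / 2"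
      by (simp_all add: mode_def)
    moreover have "norm (mode True e l t + mode False e l t) \<le> c + c"
      "norm (mode True e l t - mode False e l t) \<le> c + c"
      using c[OF that] by (intro norm_triangle_le norm_triangle_le_diff add_mono; simp)+
    ultimately show ?thesis by (simp only: norm_divide) simp
  qed
  define l' where "l' = (if 0 \<le> l then l else l + pi)"
  have l': "l' \<in> {0..pi}" "l = l' \<or> l = l' - pi" using l by (auto simp: l'_def)
  show ?thesis
  proof (cases "0 \<le> t")
    case True
    then show ?thesis using l' t *[of l' t] by auto
  next
    case False
    then have t': "- t \<in> {0..pi}" using t by auto
    then show ?thesis
      using l' t' *[of l' "- t"] sym unfolding glide_symmetric_def by fastforce
  qed
qed

section \<open>Modes of a function analytic in a stadium\<close>

text \<open>The two half-intervals \<open>[-\<pi>,0]\<close> and \<open>[0,\<pi>]\<close> that a mode combines have the midpoints \<open>-\<pi>/2\<close> and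
  \<open>\<pi>/2\<close>, and the discs of radius \<open>\<beta>\<close> about both lie in the stadium. Adding the two Taylor expansions
  and applying Cauchy's inequalities gives an expansion of the mode about the midpoint \<open>\<pi>/2\<close> of its
  domain.\<close>

lemma mode_power_series:
  assumes f: "analytic_bounded_in_stadium \<beta> f" and \<beta>: "pi / 2 < \<beta>"
  shows "\<exists>C\<ge>0. \<forall>s. \<forall>t\<in>{0..pi}. \<exists>a. (\<forall>m. norm (a m) \<le> C / \<beta> ^ m) \<and>
           (\<forall>l\<in>{0..pi}. (\<lambda>m. a m * complex_of_real (l - pi / 2) ^ m) sums mode s f l t)"
proof -
  have \<beta>0: "0 < \<beta>" using \<beta> pi_gt_zero by linarith
  from f obtain C where C: "\<forall>t\<in>{-pi..pi}. \<exists>F. F analytic_on stadium \<beta> \<and>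
        (\<forall>l\<in>{-pi..pi}. F (complex_of_real l) = f l t) \<and> (\<forall>z\<in>stadium \<beta>. cmod (F z) \<le> C)"
    unfolding analytic_bounded_in_stadium_def by blast
  have disc: "cball (complex_of_real x) \<beta> \<subseteq> stadium \<beta>" if "x \<in> {-pi..pi}" for x
  proof
    fix z assume "z \<in> cball (complex_of_real x) \<beta>"
    then have "dist z (complex_of_real x) \<le> \<beta>" by (simp add: dist_commute)
    moreover have "infdist z (complex_of_real ` {-pi..pi}) \<le> dist z (complex_of_real x)"
      using that by (intro infdist_le) simp
    ultimately show "z \<in> stadium \<beta>" by (simp add: stadium_def)
  qed
  have "\<exists>a. (\<forall>m. norm (a m) \<le> 2 * C / \<beta> ^ m) \<and>
           (\<forall>l\<in>{0..pi}. (\<lambda>m. a m * complex_of_real (l - pi / 2) ^ m) sums mode s f l t)"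
    if "t \<in> {0..pi}" for s t
  proof -
    have "t \<in> {-pi..pi}" using that by auto
    with C obtain F where F: "F analytic_on stadium \<beta>"
      "\<And>l. l \<in> {-pi..pi} \<Longrightarrow> F (complex_of_real l) = f l t"
      "\<And>z. z \<in> stadium \<beta> \<Longrightarrow> cmod (F z) \<le> C" by blast
    define b where "b x m = (deriv ^^ m) F (complex_of_real x) / fact m" for x m
    have hol: "F holomorphic_on cball (complex_of_real x) \<beta>" if "x \<in> {-pi..pi}" for x
      using analytic_imp_holomorphic[OF F(1)] disc[OF that] by (rule holomorphic_on_subset)
    have bb: "norm (b x m) \<le> C / \<beta> ^ m" if x: "x \<in> {-pi..pi}" for x m
    proof -
      have "norm ((deriv ^^ m) F (complex_of_real x)) \<le> fact m * C / \<beta> ^ m"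
      proof (rule Cauchy_inequality[OF _ _ \<beta>0])
        show "F holomorphic_on ball (complex_of_real x) \<beta>"
          using hol[OF x] ball_subset_cball by (rule holomorphic_on_subset)
        show "continuous_on (cball (complex_of_real x) \<beta>) F"
          using hol[OF x] by (rule holomorphic_on_imp_continuous_on)
        show "norm (F z) \<le> C" if "norm (complex_of_real x - z) = \<beta>" for z
          using that disc[OF x] by (intro F(3)) (auto simp: dist_norm)
      qed
      then show ?thesis by (simp add: b_def norm_divide field_simps)
    qed
    have bs: "(\<lambda>m. b x m * complex_of_real y ^ m) sums f (x + y) t"
      if x: "x \<in> {-pi..pi}" and y: "\<bar>y\<bar> \<le> pi / 2" and xy: "x + y \<in> {-pi..pi}" for x y
    proof -
      have "F holomorphic_on ball (complex_of_real x) \<beta>"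
        using hol[OF x] ball_subset_cball by (rule holomorphic_on_subset)
      moreover have "complex_of_real (x + y) \<in> ball (complex_of_real x) \<beta>"
        using y \<beta> by (simp add: dist_norm)
      ultimately have "(\<lambda>m. (deriv ^^ m) F (complex_of_real x) / fact m *
          (complex_of_real (x + y) - complex_of_real x) ^ m) sums F (complex_of_real (x + y))"
        by (rule holomorphic_power_series)
      then show ?thesis using F(2)[OF xy] by (simp add: b_def)
    qed
    define a where "a m = b (- pi / 2) m + (if s then b (pi / 2) m else - b (pi / 2) m)" for m
    have "norm (a m) \<le> 2 * C / \<beta> ^ m" for m
    proof -
      have "norm (a m) \<le> norm (b (- pi / 2) m) + norm (b (pi / 2) m)"
        using norm_triangle_ineq norm_triangle_ineq4 by (auto simp: a_def)
      also have "\<dots> \<le> C / \<beta> ^ m + C / \<beta> ^ m"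
        by (intro add_mono bb) (auto simp: field_simps)
      finally show ?thesis by simp
    qed
    moreover have "(\<lambda>m. a m * complex_of_real (l - pi / 2) ^ m) sums mode s f l t"
      if l: "l \<in> {0..pi}" for l
    proof -
      have y: "\<bar>l - pi / 2\<bar> \<le> pi / 2" using l by (simp only: atLeastAtMost_iff abs_le_iff) linarith
      have shift: "- pi / 2 + (l - pi / 2) = l - pi" "pi / 2 + (l - pi / 2) = l" by simp_all
      have 1: "(\<lambda>m. b (- pi / 2) m * complex_of_real (l - pi / 2) ^ m) sums f (l - pi) t"
        using bs[of "- pi / 2" "l - pi / 2", unfolded shift] y l by auto
      have 2: "(\<lambda>m. b (pi / 2) m * complex_of_real (l - pi / 2) ^ m) sums f l t"
        using bs[of "pi / 2" "l - pi / 2", unfolded shift] y l by auto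
      show ?thesis
        using sums_add[OF 1 2] sums_diff[OF 1 2]
        by (cases s) (simp_all add: a_def mode_def algebra_simps)
    qed
    ultimately show ?thesis by blast
  qed
  moreover have "0 \<le> C"
  proof -
    have "(0::real) \<in> {-pi..pi}" by simp
    with C obtain F where "\<forall>z\<in>stadium \<beta>. cmod (F z) \<le> C" by blast
    moreover have "0 \<in> stadium \<beta>" using disc[of 0] \<beta>0 by (auto simp: subset_iff)
    ultimately show ?thesis using norm_ge_zero order_trans by blast
  qed
  ultimately show ?thesis by (intro exI[of _ "2 * C"]) auto
qed

text \<open>Rescaling \<open>[0,\<pi>]\<close> to \<open>[-1,1]\<close> multiplies the \<open>m\<close>-th Taylor coefficient by \<open>(\<pi>/2) ^ m\<close>, so
  the scaled coefficients decay like \<open>(\<pi> / (2 \<beta>)) ^ m = (1 / (2 \<gamma>) * (1 / \<rho>)) ^ m\<close>. The factor \<open>1 / \<rho>\<close> is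
  spent on convergence, the factor \<open>1 / (2 \<gamma>)\<close> on the quadratic exponent.\<close>

lemma mode_determinant_bound:
  assumes f: "analytic_bounded_in_stadium \<beta> f" and \<beta>: "\<beta> = \<gamma> * \<rho> * pi" and \<gamma>: "1 \<le> \<gamma>" and \<rho>: "1 < \<rho>"
  shows "\<exists>D\<ge>0. \<forall>s n x y. (\<forall>i<n. x i \<in> {0..pi}) \<longrightarrow> (\<forall>i<n. y i \<in> {0..pi}) \<longrightarrow>
      norm (Determinant.det (Matrix.mat n n (\<lambda>(i, j). mode s f (y j) (x i))))
        \<le> fact n * D ^ n / sqrt (2 * \<gamma>) ^ (n * (n - 1))"
proof -
  have \<gamma>\<rho>: "1 < \<gamma> * \<rho>" using \<gamma> \<rho> mult_mono[of 1 \<gamma> 1 \<rho>] by (smt (verit) mult_less_cancel_right2)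
  have \<beta>2: "pi / 2 < \<beta>" unfolding \<beta> using \<gamma>\<rho> pi_gt_zero by (smt (verit) field_sum_of_halves mult_less_cancel_right2)
  obtain C where C: "0 \<le> C" "\<And>s t. t \<in> {0..pi} \<Longrightarrow> \<exists>a. (\<forall>m. norm (a m) \<le> C / \<beta> ^ m) \<and>
      (\<forall>l\<in>{0..pi}. (\<lambda>m. a m * complex_of_real (l - pi / 2) ^ m) sums mode s f l t)"
    using mode_power_series[OF f \<beta>2] by blast
  define D where "D = C / (1 - 1 / \<rho>)"
  show ?thesis
  proof (rule exI[of _ D], intro conjI allI impI)
    show "0 \<le> D" using C \<rho> by (simp add: D_def)
    fix s n and x y :: "nat \<Rightarrow> real"
    assume x: "\<forall>i<n. x i \<in> {0..pi}" and y: "\<forall>i<n. y i \<in> {0..pi}"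
    obtain a where a: "\<And>i m. i < n \<Longrightarrow> norm (a i m) \<le> C / \<beta> ^ m"
      "\<And>i l. i < n \<Longrightarrow> l \<in> {0..pi} \<Longrightarrow>
         (\<lambda>m. a i m * complex_of_real (l - pi / 2) ^ m) sums mode s f l (x i)"
    proof -
      have "\<forall>i. \<exists>a. i < n \<longrightarrow> (\<forall>m. norm (a m) \<le> C / \<beta> ^ m) \<and>
        (\<forall>l\<in>{0..pi}. (\<lambda>m. a m * complex_of_real (l - pi / 2) ^ m) sums mode s f l (x i))"
        using C(2) x by meson
      then show thesis using that by metis
    qed
    have "norm (Determinant.det (Matrix.mat n n (\<lambda>(i, j). mode s f (y j) (x i))))
       \<le> fact n * (C / (1 - 1 / \<rho>)) ^ n * (1 / (2 * \<gamma>)) ^ (n * (n - 1) div 2)"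
    proof (rule interpolation_determinant_bound[where t = "\<lambda>j. complex_of_real ((y j - pi / 2) / (pi / 2))"
          and a = "\<lambda>i m. a i m * complex_of_real (pi / 2) ^ m"])
      fix i m assume "i < n"
      have "norm (a i m * complex_of_real (pi / 2) ^ m) = norm (a i m) * (pi / 2) ^ m"
        by (simp add: norm_mult norm_power norm_divide)
      also have "\<dots> \<le> C / \<beta> ^ m * (pi / 2) ^ m"
        using a(1)[OF \<open>i < n\<close>] by (intro mult_right_mono) auto
      also have "\<dots> = C * (1 / (2 * \<gamma>) * (1 / \<rho>)) ^ m"
        using \<gamma> \<rho> unfolding \<beta> by (simp add: field_simps power_mult_distrib power_divide)
      finally show "norm (a i m * complex_of_real (pi / 2) ^ m) \<le> C * (1 / (2 * \<gamma>) * (1 / \<rho>)) ^ m" .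
    next
      fix j assume "j < n"
      then have "y j \<in> {0..pi}" using y by blast
      then have "\<bar>y j - pi / 2\<bar> \<le> pi / 2"
        by (simp only: atLeastAtMost_iff abs_le_iff) linarith
      then show "norm (complex_of_real ((y j - pi / 2) / (pi / 2))) \<le> 1"
        by (simp only: norm_of_real abs_divide) (simp add: field_simps)
    next
      fix i j assume ij: "i < n" "j < n"
      have "a i m * complex_of_real (pi / 2) ^ m * complex_of_real ((y j - pi / 2) / (pi / 2)) ^ m
          = a i m * complex_of_real (y j - pi / 2) ^ m" for m
      proof -
        have "complex_of_real (pi / 2) ^ m * complex_of_real ((y j - pi / 2) / (pi / 2)) ^ m
          = complex_of_real (pi / 2 * ((y j - pi / 2) / (pi / 2))) ^ m"
          by (simp only: power_mult_distrib[symmetric] of_real_mult)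
        also have "pi / 2 * ((y j - pi / 2) / (pi / 2)) = y j - pi / 2" by simp
        finally show ?thesis by (simp only: mult.assoc)
      qed
      then show "(\<lambda>m. a i m * complex_of_real (pi / 2) ^ m *
          complex_of_real ((y j - pi / 2) / (pi / 2)) ^ m) sums mode s f (y j) (x i)"
        using a(2)[OF ij(1), of "y j"] y ij by (simp only:)
    qed (use C \<gamma> \<rho> in auto)
    also have "(1 / (2 * \<gamma>)) ^ (n * (n - 1) div 2) = 1 / sqrt (2 * \<gamma>) ^ (n * (n - 1))"
    proof -
      have "sqrt (2 * \<gamma>) ^ (n * (n - 1)) = (sqrt (2 * \<gamma>))\<^sup>2 ^ (n * (n - 1) div 2)"
      proof -
        have "even (n * (n - 1))" by (cases n) auto
        then show ?thesis by (simp add: power_mult[symmetric] del: One_nat_def)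
      qed
      then show ?thesis using \<gamma> by (simp add: power_divide)
    qed
    finally show "norm (Determinant.det (Matrix.mat n n (\<lambda>(i, j). mode s f (y j) (x i))))
        \<le> fact n * D ^ n / sqrt (2 * \<gamma>) ^ (n * (n - 1))"
      by (simp add: D_def)
  qed
qed

section \<open>Convergence\<close>

lemma GE_run_fa:
  assumes "GE_run \<alpha> f e fa" "l \<in> {-pi..pi}" "t \<in> {-pi..pi}"
  shows "fa k l t = f l t - e k l t"
proof (induction k)
  case 0
  then show ?case using assms by (simp add: GE_run_def)
next
  case (Suc k)
  show ?case
  proof (cases "\<exists>l\<in>{-pi..pi}. \<exists>t\<in>{-pi..pi}. e k l t \<noteq> 0")
    case True
    then obtain l0 t0 where
      "e (Suc k) l t = e k l t - GE_update \<alpha> (e k) l0 t0 l t \<and>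
       fa (Suc k) l t = fa k l t + GE_update \<alpha> (e k) l0 t0 l t"
      using assms unfolding GE_run_def by meson
    then show ?thesis using Suc by simp
  next
    case False
    then have "e (Suc k) l t = 0 \<and> fa (Suc k) l t = fa k l t"
      using assms unfolding GE_run_def by meson
    then show ?thesis using Suc False assms(2,3) by simp
  qed
qed

text \<open>The variable \<open>\<theta>\<close> is made the first argument, and \<open>\<lambda>\<close> the second, so that the rows of the
  sample matrices are the analytic functions and their columns the sample points.\<close>

lemma GE_run_nonterminating:
  assumes \<alpha>: "0 < \<alpha>" "\<alpha> \<le> 1" and f: "glide_symmetric f" and run: "GE_run \<alpha> f e fa"
    and nz: "\<And>k. \<exists>l\<in>{-pi..pi}. \<exists>t\<in>{-pi..pi}. e k l t \<noteq> 0"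
  shows "\<exists>x y. coupled_elimination {0..pi} {0..pi} \<alpha> (\<lambda>s k t l. mode s (e k) l t) x y \<and>
    (\<forall>k. glide_symmetric (e k))"
proof -
  have "\<forall>k. \<exists>l0 t0. maximal_pivot (e k) l0 t0 \<and> (\<forall>l\<in>{-pi..pi}. \<forall>t\<in>{-pi..pi}.
      e (Suc k) l t = e k l t - GE_update \<alpha> (e k) l0 t0 l t)"
    using run nz unfolding GE_run_def by meson
  then obtain y x where max: "\<And>k. maximal_pivot (e k) (y k) (x k)"
    and step: "\<And>k l t. l \<in> {-pi..pi} \<Longrightarrow> t \<in> {-pi..pi} \<Longrightarrow>
      e (Suc k) l t = e k l t - GE_update \<alpha> (e k) (y k) (x k) l t"
    by metis
  have pts: "y k \<in> {0..pi}" "x k \<in> {0..pi}" for k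
    using max by (auto simp: maximal_pivot_def)
  have sym: "glide_symmetric (e k)" for k
  proof (induction k)
    case 0
    have "e 0 l t = f l t" if "l \<in> {-pi..pi}" "t \<in> {-pi..pi}" for l t
      using run that unfolding GE_run_def by blast
    then show ?case using f unfolding glide_symmetric_def by simp
  next
    case (Suc k)
    show ?case by (rule GE_step_glide_symmetric[OF \<alpha> Suc pts step])
  qed
  have le: "norm (mode s (e k) l t)
      \<le> max (norm (mode True (e k) (y k) (x k))) (norm (mode False (e k) (y k) (x k)))"
    if "l \<in> {0..pi}" "t \<in> {0..pi}" for s k l t
  proof -
    have "norm (mode s (e k) l t) \<le> sigma1 (pivot_at (e k) l t)"
      unfolding sigma1_pivot_at by (cases s) auto
    also have "\<dots> \<le> sigma1 (pivot_at (e k) (y k) (x k))"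
      using max that unfolding maximal_pivot_def by blast
    finally show ?thesis unfolding sigma1_pivot_at .
  qed
  have pos: "0 < max (norm (mode True (e k) (y k) (x k))) (norm (mode False (e k) (y k) (x k)))" for k
  proof -
    obtain l t where lt: "l \<in> {-pi..pi}" "t \<in> {-pi..pi}" "e k l t \<noteq> 0" using nz by blast
    have "norm (e k l t) \<le>
      max (norm (mode True (e k) (y k) (x k))) (norm (mode False (e k) (y k) (x k)))"
      by (rule norm_le_of_modes[OF sym lt(1,2) le])
    with lt(3) show ?thesis by (smt (verit) zero_less_norm_iff)
  qed
  have "coupled_elimination {0..pi} {0..pi} \<alpha> (\<lambda>s k t l. mode s (e k) l t) x y"
  proof
    show "0 < \<alpha>" "\<alpha> \<le> 1" by fact+
    show "x k \<in> {0..pi}" "y k \<in> {0..pi}" for k by (rule pts)+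
  next
    fix s k u v assume *: "\<alpha> * cmod (mode (\<not> s) (e k) (y k) (x k)) \<le> cmod (mode s (e k) (y k) (x k))"
      "u \<in> {0..pi}" "v \<in> {0..pi}"
    show "mode s (e (Suc k)) v u = mode s (e k) v u -
        mode s (e k) v (x k) * mode s (e k) (y k) u / mode s (e k) (y k) (x k)"
      using GE_step_mode[OF \<alpha> sym pts step *(3,2)] *(1) by (simp add: mode_coeff_def mult_ac)
  next
    fix s k u v assume *: "\<not> \<alpha> * cmod (mode (\<not> s) (e k) (y k) (x k)) \<le> cmod (mode s (e k) (y k) (x k))"
      "u \<in> {0..pi}" "v \<in> {0..pi}"
    show "mode s (e (Suc k)) v u = mode s (e k) v u"
      using GE_step_mode[OF \<alpha> sym pts step *(3,2)] *(1) by (simp add: mode_coeff_def)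
  qed (use le pos in auto)
  then show ?thesis using sym by blast
qed

text \<open>The bound \<open>S\<close> is only required to hold eventually, so that a run that stops after finitely many
  steps can be treated with \<open>S = 0\<close>. All other runs fall under \<open>S_tendsto_0\<close>.\<close>

lemma GE_error_tendsto_0:
  fixes \<alpha> \<rho> \<beta> :: real
  assumes \<alpha>: "0 < \<alpha>" "\<alpha> \<le> 1" and \<rho>: "\<rho> > 1"
    and \<beta>: "\<beta> = max 3 (sqrt (1 + 4 / \<alpha>)) * \<rho> * pi"
    and "BMC f"
    and f: "analytic_bounded_in_stadium \<beta> f"
    and run: "GE_run \<alpha> f e fa"
  shows "\<exists>S. S \<longlonglongrightarrow> (0::real) \<and> 
    (\<forall>\<^sub>F k in sequentially. \<forall>l\<in>{-pi..pi}. \<forall>t\<in>{-pi..pi}. norm (e k l t) \<le> S k)"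
proof (cases "\<forall>k. \<exists>l\<in>{-pi..pi}. \<exists>t\<in>{-pi..pi}. e k l t \<noteq> 0")
  case True
  then obtain x y where "coupled_elimination {0..pi} {0..pi} \<alpha> (\<lambda>s k t l. mode s (e k) l t) x y"
    and sym: "\<And>k. glide_symmetric (e k)"
    using GE_run_nonterminating[OF \<alpha> BMC_imp_glide_symmetric[OF \<open>BMC f\<close>] run] by blast
  then interpret coupled_elimination "{0..pi}" "{0..pi}" \<alpha> "\<lambda>s k t l. mode s (e k) l t" x y
    "\<lambda>s k. mode s (e k) (y k) (x k)" 
    "\<lambda>s k. \<alpha> * norm (mode (\<not> s) (e k) (y k) (x k)) \<le> norm (mode s (e k) (y k) (x k))"
    "\<lambda>k. max (norm (mode True (e k) (y k) (x k))) (norm (mode False (e k) (y k) (x k)))"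
    by simp_all
  define \<gamma> where "\<gamma> = max 3 (sqrt (1 + 4 / \<alpha>))"
  have \<gamma>: "3 \<le> \<gamma>" "1 + 4 / \<alpha> \<le> \<gamma>\<^sup>2"
    unfolding \<gamma>_def using real_sqrt_le_iff sqrt_le_D by (auto simp: le_max_iff_disj real_sqrt_le_iff intro: sqrt_le_D)
  \<comment> \<open>Any \<open>g\<close> with \<open>g\<^sup>2 \<ge> 4\<close>, \<open>g ^ 4 \<ge> 2 + 2 / \<alpha>\<close> and \<open>g < h\<close> would do.
    The \<open>3\<close> in \<open>\<gamma>\<close> serves the first condition, the root the second.\<close>
  define g where "g = sqrt (4 * \<gamma> / 3)"
  define h where "h = sqrt (2 * \<gamma>)"
  have g2: "g\<^sup>2 = 4 * \<gamma> / 3" using \<gamma> by (simp add: g_def)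
  have g3: "2 \<le> g" unfolding g_def using \<gamma> by (intro real_le_rsqrt) simp
  have g4: "2 + 2 / \<alpha> \<le> g ^ 4"
  proof -
    have "g ^ 4 = (g\<^sup>2)\<^sup>2" by simp
    also have "\<dots> = 16 / 9 * \<gamma>\<^sup>2" unfolding g2 by (simp add: power2_eq_square)
    also have "\<dots> \<ge> 16 / 9 * (1 + 4 / \<alpha>)" using \<gamma> by simp
    moreover have "2 + 2 / \<alpha> \<le> 16 / 9 * (1 + 4 / \<alpha>)" using \<alpha> by (simp add: field_simps)
    ultimately show ?thesis by linarith
  qed
  have gh: "g < h" unfolding g_def h_def using \<gamma> by simp
  obtain D where D: "0 \<le> D" "\<And>s n x y. (\<forall>i<n. x i \<in> {0..pi}) \<Longrightarrow> (\<forall>i<n. y i \<in> {0..pi}) \<Longrightarrow>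
      norm (Determinant.det (Matrix.mat n n (\<lambda>(i, j). mode s f (y j) (x i))))
        \<le> fact n * D ^ n / h ^ (n * (n - 1))"
    using mode_determinant_bound[OF f \<beta>[folded \<gamma>_def] _ \<rho>] \<gamma> unfolding h_def by (meson order_trans one_le_numeral)
  have "norm (Determinant.det (Matrix.mat n n (\<lambda>(i, j). mode s (e 0) (y' j) (x' i))))
        \<le> fact n * D ^ n / h ^ (n * (n - 1))"
    if xy: "\<And>i. i < n \<Longrightarrow> x' i \<in> {0..pi}" "\<And>i. i < n \<Longrightarrow> y' i \<in> {0..pi}" for s n x' y'
  proof -
    have e0: "e 0 l t = f l t" if "l \<in> {-pi..pi}" "t \<in> {-pi..pi}" for l t
      using run that unfolding GE_run_def by blast
    have "mode s (e 0) (y' j) (x' i) = mode s f (y' j) (x' i)" if "i < n" "j < n" for i j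
      unfolding mode_def using xy(1)[OF that(1)] xy(2)[OF that(2)] by (auto simp: e0)
    then have "Matrix.mat n n (\<lambda>(i, j). mode s (e 0) (y' j) (x' i)) =
               Matrix.mat n n (\<lambda>(i, j). mode s f (y' j) (x' i))"
      by (intro eq_matI) auto
    then show ?thesis using D(2)[of n x' y' s] xy by simp
  qed
  then have "(\<lambda>k. max (norm (mode True (e k) (y k) (x k))) (norm (mode False (e k) (y k) (x k))))
      \<longlonglongrightarrow> 0"
    by (rule S_tendsto_0[OF g3 g4 gh D(1)])
  moreover have "norm (e k l t) \<le>
      max (norm (mode True (e k) (y k) (x k))) (norm (mode False (e k) (y k) (x k)))"
    if "l \<in> {-pi..pi}" "t \<in> {-pi..pi}" for k l t
    using sym that by (rule norm_le_of_modes) (rule norm_le_S)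
  ultimately show ?thesis by (intro exI conjI always_eventually) auto
next
  case False
  then obtain K where K: "\<And>l t. l \<in> {-pi..pi} \<Longrightarrow> t \<in> {-pi..pi} \<Longrightarrow> e K l t = 0" by blast
  have "\<forall>l\<in>{-pi..pi}. \<forall>t\<in>{-pi..pi}. e k l t = 0" if "K \<le> k" for k
    using that
  proof (induction k rule: dec_induct)
    case (step k)
    then have "\<not> (\<exists>l\<in>{-pi..pi}. \<exists>t\<in>{-pi..pi}. e k l t \<noteq> 0)" by blast
    then show ?case using run unfolding GE_run_def by meson
  qed (use K in blast)
  then show ?thesis
    by (intro exI[of _ "\<lambda>_. 0"]) (auto intro!: eventually_sequentiallyI[of K])
qed

theorem theorem3p5:
  fixes \<alpha> \<rho> \<beta> :: real
    and f :: "real \<Rightarrow> real \<Rightarrow> complex"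
    and e fa :: "nat \<Rightarrow> real \<Rightarrow> real \<Rightarrow> complex"
  assumes "0 < \<alpha>" and "\<alpha> \<le> 1" and "\<rho> > 1"
    and "\<beta> = max 3 (sqrt (1 + 4 / \<alpha>)) * \<rho> * pi"
    and "BMC f"
    and "\<And>l. l \<in> {-pi..pi} \<Longrightarrow> continuous_on {-pi..pi} (f l)"
    and "analytic_bounded_in_stadium \<beta> f"
    and "GE_run \<alpha> f e fa"
  shows "(\<lambda>k. supnorm (e k)) \<longlonglongrightarrow> 0 \<and>
         uniform_limit ({-pi..pi} \<times> {-pi..pi}) (\<lambda>k (l, t). fa k l t) (\<lambda>(l, t). f l t) sequentially"
proof
  obtain S where S: "S \<longlonglongrightarrow> (0::real)"
    "\<forall>\<^sub>F k in sequentially. \<forall>l\<in>{-pi..pi}. \<forall>t\<in>{-pi..pi}. norm (e k l t) \<le> S k"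
    using GE_error_tendsto_0[OF assms(1-5,7,8)] by blast
  have "\<forall>\<^sub>F k in sequentially. norm (supnorm (e k)) \<le> S k"
    using S(2)
  proof eventually_elim
    case (elim k)
    then have "(SUP (l, t) \<in> {-pi..pi} \<times> {-pi..pi}. cmod (e k l t)) \<le> S k"
      by (intro cSUP_least) auto
    moreover have "cmod (e k 0 0) \<le> (SUP (l, t) \<in> {-pi..pi} \<times> {-pi..pi}. cmod (e k l t))"
      by (rule cSUP_upper2[where x = "(0, 0)"])
         (use elim in \<open>auto intro!: bdd_aboveI2[where M = "S k"]\<close>)
    ultimately show ?case
      unfolding supnorm_def real_norm_def using norm_ge_zero[of "e k 0 0"] by linarith
  qed
  then show "(\<lambda>k. supnorm (e k)) \<longlonglongrightarrow> 0"
    by (rule Lim_null_comparison[OF _ S(1)])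
  show "uniform_limit ({-pi..pi} \<times> {-pi..pi}) (\<lambda>k (l, t). fa k l t) (\<lambda>(l, t). f l t) sequentially"
  proof (rule uniform_limitI)
    fix \<epsilon> :: real assume "0 < \<epsilon>"
    with S(1) have "\<forall>\<^sub>F k in sequentially. S k < \<epsilon>" by (rule order_tendstoD)
    with S(2) show "\<forall>\<^sub>F k in sequentially. \<forall>p\<in>{-pi..pi} \<times> {-pi..pi}.
        dist (case p of (l, t) \<Rightarrow> fa k l t) (case p of (l, t) \<Rightarrow> f l t) < \<epsilon>"
      by eventually_elim (force simp: dist_norm GE_run_fa[OF assms(8)])
  qed
qed

end
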